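(* Let $\Gamma$ be a non-elementary hyperbolic group, equipped with the word-length $|\cdot|$ given by a finite symmetric generating set $S$. For $k\ge 0$ let $\sigma_k=\sum_{|\gamma|=k}\gamma\in\mathbb{C}\Gamma$, and let $\lambda$ denote the left-regular representation on $\ell^2\Gamma$. Then there are constants $c,C>0$, depending only on $\Gamma$ and $S$, such that for every finite sum $a=\sum_k a_k\sigma_k\in\mathbb{C}\Gamma$ with all $a_k\geq 0$, $$c\,\sum_k (k+1)\,\|a_k\sigma_k\|_2\;\le\;\|\lambda(a)\|\;\le\; C\,\sum_k (k+1)\,\|a_k\sigma_k\|_2 .$$
   Context: $\mathbb{C}\Gamma$ is the complex group algebra, i.e. finitely supported functions $a:\Gamma\to\mathbb{C}$, written $a=\sum_\gamma a(\gamma)\gamma$. The norm $\|a\|_2=\big(\sum_\gamma|a(\gamma)|^2\big)^{1/2}$ is the $\ell^2$-norm. The left-regular representation is extended linearly to $\mathbb{C}\Gamma$, so $\lambda(a)$ is left convolution by $a$ on $\ell^2\Gamma$, and $\|\lambda(a)\|$ is its operator norm. Non-elementary means neither finite nor virtually infinite cyclic. *)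

theory Defs
  imports "HOL-Analysis.Analysis" "HOL-Algebra.Algebra"
begin

section \<open>Word length and hyperbolic groups\<close>

definition fin_sym_gen_set :: "('a, 'b) monoid_scheme \<Rightarrow> 'a set \<Rightarrow> bool" where
  "fin_sym_gen_set G S \<longleftrightarrow>
     finite S \<and> S \<subseteq> carrier G \<and> (\<forall>s\<in>S. inv\<^bsub>G\<^esub> s \<in> S) \<and> generate G S = carrier G"

text \<open>Since the generating set is symmetric, words in the letters of \<open>S\<close> suffice.\<close>

definition word_length :: "('a, 'b) monoid_scheme \<Rightarrow> 'a set \<Rightarrow> 'a \<Rightarrow> nat" where
  "word_length G S g =
     (LEAST n. \<exists>ws. set ws \<subseteq> S \<and> length ws = n \<and> foldr (\<otimes>\<^bsub>G\<^esub>) ws \<one>\<^bsub>G\<^esub> = g)"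

definition word_dist :: "('a, 'b) monoid_scheme \<Rightarrow> 'a set \<Rightarrow> 'a \<Rightarrow> 'a \<Rightarrow> real" where
  "word_dist G S x y = real (word_length G S (inv\<^bsub>G\<^esub> x \<otimes>\<^bsub>G\<^esub> y))"

definition gromov_product :: "('a \<Rightarrow> 'a \<Rightarrow> real) \<Rightarrow> 'a \<Rightarrow> 'a \<Rightarrow> 'a \<Rightarrow> real" where
  "gromov_product d w x y = (d x w + d y w - d x y) / 2"

definition gromov_hyperbolic :: "'a set \<Rightarrow> ('a \<Rightarrow> 'a \<Rightarrow> real) \<Rightarrow> bool" where
  "gromov_hyperbolic M d \<longleftrightarrow>
     (\<exists>\<delta>. \<forall>w\<in>M. \<forall>x\<in>M. \<forall>y\<in>M. \<forall>z\<in>M.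
        gromov_product d w x z \<ge> min (gromov_product d w x y) (gromov_product d w y z) - \<delta>)"

text \<open>Hyperbolicity is a property of the group alone: the generating set \<open>T\<close> below is not tied to
  the one used elsewhere to measure lengths.\<close>

definition hyperbolic_group :: "('a, 'b) monoid_scheme \<Rightarrow> bool" where
  "hyperbolic_group G \<longleftrightarrow>
     group G \<and> (\<exists>T. fin_sym_gen_set G T \<and> gromov_hyperbolic (carrier G) (word_dist G T))"

definition virtually_infinite_cyclic :: "('a, 'b) monoid_scheme \<Rightarrow> bool" where
  "virtually_infinite_cyclic G \<longleftrightarrow>
     (\<exists>H. subgroup H G \<and> finite (rcosets\<^bsub>G\<^esub> H) \<and> G\<lparr>carrier := H\<rparr> \<cong> integer_group)"

definition non_elementary :: "('a, 'b) monoid_scheme \<Rightarrow> bool" where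
  "non_elementary G \<longleftrightarrow> infinite (carrier G) \<and> \<not> virtually_infinite_cyclic G"


section \<open>The left-regular representation\<close>

text \<open>Functions on the group are represented as functions on the whole type that vanish outside
  the carrier.\<close>

definition ell2 :: "('a, 'b) monoid_scheme \<Rightarrow> ('a \<Rightarrow> complex) set" where
  "ell2 G = {f. (\<forall>x. x \<notin> carrier G \<longrightarrow> f x = 0) \<and> (\<lambda>x. (cmod (f x))\<^sup>2) summable_on carrier G}"

definition ell2_norm :: "('a, 'b) monoid_scheme \<Rightarrow> ('a \<Rightarrow> complex) \<Rightarrow> real" where
  "ell2_norm G f = sqrt (\<Sum>\<^sub>\<infinity>x\<in>carrier G. (cmod (f x))\<^sup>2)"

definition group_algebra :: "('a, 'b) monoid_scheme \<Rightarrow> ('a \<Rightarrow> complex) set" where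
  "group_algebra G = {a. finite {x. a x \<noteq> 0} \<and> {x. a x \<noteq> 0} \<subseteq> carrier G}"

definition left_translate ::
  "('a, 'b) monoid_scheme \<Rightarrow> 'a \<Rightarrow> ('a \<Rightarrow> complex) \<Rightarrow> 'a \<Rightarrow> complex" where
  "left_translate G g f = (\<lambda>x. if x \<in> carrier G then f (inv\<^bsub>G\<^esub> g \<otimes>\<^bsub>G\<^esub> x) else 0)"

definition left_regular ::
  "('a, 'b) monoid_scheme \<Rightarrow> ('a \<Rightarrow> complex) \<Rightarrow> ('a \<Rightarrow> complex) \<Rightarrow> 'a \<Rightarrow> complex" where
  "left_regular G a f = (\<lambda>x. \<Sum>g | a g \<noteq> 0. a g * left_translate G g f x)"

text \<open>The supremum is meaningful for bounded operators only; lemma \<open>bdd_above_left_regular\<close> below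
  covers the operators to which it is applied.\<close>

definition ell2_op_norm ::
  "('a, 'b) monoid_scheme \<Rightarrow> (('a \<Rightarrow> complex) \<Rightarrow> 'a \<Rightarrow> complex) \<Rightarrow> real" where
  "ell2_op_norm G T = (SUP f \<in> {f \<in> ell2 G. ell2_norm G f \<le> 1}. ell2_norm G (T f))"

definition sphere_sum :: "('a, 'b) monoid_scheme \<Rightarrow> 'a set \<Rightarrow> nat \<Rightarrow> 'a \<Rightarrow> complex" where
  "sphere_sum G S k = (\<lambda>x. if x \<in> carrier G \<and> word_length G S x = k then 1 else 0)"


section \<open>Well-definedness\<close>

lemma (in group) generate_imp_word:
  assumes S: "fin_sym_gen_set G S" and x: "x \<in> carrier G"
  shows "\<exists>ws. set ws \<subseteq> S \<and> foldr (\<otimes>) ws \<one> = x"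
proof -
  have sub: "S \<subseteq> carrier G" and sym: "\<And>s. s \<in> S \<Longrightarrow> inv s \<in> S"
    and gen: "generate G S = carrier G"
    using S by (auto simp: fin_sym_gen_set_def)
  have closed: "foldr (\<otimes>) ws \<one> \<in> carrier G" if "set ws \<subseteq> S" for ws
    using that sub by (induction ws) auto
  have app: "foldr (\<otimes>) (us @ vs) \<one> = foldr (\<otimes>) us \<one> \<otimes> foldr (\<otimes>) vs \<one>"
    if "set us \<subseteq> S" "set vs \<subseteq> S" for us vs
    using that
  proof (induction us)
    case Nil
    then show ?case using closed by simp
  next
    case (Cons u us)
    then have "u \<in> carrier G" "set us \<subseteq> S" using sub by auto
    then show ?case using Cons closed[of us] closed[of vs] by (simp add: m_assoc)
  qed
  have "x \<in> generate G S" using gen x by simp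
  then show ?thesis
  proof (induction rule: generate.induct)
    case one
    show ?case by (rule exI[of _ "[]"]) simp
  next
    case (incl h)
    then have "h \<in> carrier G" using sub by blast
    then show ?case using incl by (intro exI[of _ "[h]"]) simp
  next
    case (inv h)
    then have "inv h \<in> S" using sym by blast
    moreover from this have "inv h \<in> carrier G" using sub by blast
    ultimately show ?case by (intro exI[of _ "[inv h]"]) simp
  next
    case (eng h1 h2)
    then obtain us vs where "set us \<subseteq> S" "foldr (\<otimes>) us \<one> = h1" "set vs \<subseteq> S" "foldr (\<otimes>) vs \<one> = h2"
      by blast
    then show ?case using app[of us vs] by (intro exI[of _ "us @ vs"]) auto
  qed
qed

lemma (in group) sphere_sum_in_group_algebra:
  assumes S: "fin_sym_gen_set G S"
  shows "sphere_sum G S k \<in> group_algebra G"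
proof -
  have "x \<in> (\<lambda>ws. foldr (\<otimes>) ws \<one>) ` {ws. set ws \<subseteq> S \<and> length ws = k}"
    if x: "x \<in> carrier G" "word_length G S x = k" for x
  proof -
    obtain ws where "set ws \<subseteq> S" "foldr (\<otimes>) ws \<one> = x"
      using generate_imp_word[OF S x(1)] by blast
    then have "\<exists>n ws. set ws \<subseteq> S \<and> length ws = n \<and> foldr (\<otimes>) ws \<one> = x" by blast
    from LeastI_ex[OF this] show ?thesis
      using x(2) unfolding word_length_def by blast
  qed
  then have "{x. sphere_sum G S k x \<noteq> 0}
      \<subseteq> (\<lambda>ws. foldr (\<otimes>) ws \<one>) ` {ws. set ws \<subseteq> S \<and> length ws = k}"
    by (auto simp: sphere_sum_def split: if_splits)
  moreover have "finite {ws. set ws \<subseteq> S \<and> length ws = k}"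
    using S by (intro finite_lists_length_eq) (simp add: fin_sym_gen_set_def)
  ultimately have "finite {x. sphere_sum G S k x \<noteq> 0}"
    by (meson finite_imageI finite_subset)
  then show ?thesis by (auto simp: group_algebra_def sphere_sum_def split: if_splits)
qed

lemma (in group) left_translate_norm:
  assumes g: "g \<in> carrier G" and f: "f \<in> ell2 G"
  shows "(\<lambda>x. (cmod (left_translate G g f x))\<^sup>2) summable_on carrier G"
    and "(\<Sum>\<^sub>\<infinity>x\<in>carrier G. (cmod (left_translate G g f x))\<^sup>2) = (\<Sum>\<^sub>\<infinity>x\<in>carrier G. (cmod (f x))\<^sup>2)"
proof -
  have bij: "bij_betw (\<lambda>x. inv g \<otimes> x) (carrier G) (carrier G)"
    by (rule bij_betwI[where g = "\<lambda>x. g \<otimes> x"]) (use g in \<open>auto simp: m_assoc[symmetric]\<close>)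
  have eq: "(cmod (left_translate G g f x))\<^sup>2 = (cmod (f (inv g \<otimes> x)))\<^sup>2" if "x \<in> carrier G" for x
    using that by (simp add: left_translate_def)
  show "(\<lambda>x. (cmod (left_translate G g f x))\<^sup>2) summable_on carrier G"
    using summable_on_reindex_bij_betw[OF bij, of "\<lambda>x. (cmod (f x))\<^sup>2"] f
      summable_on_cong[of "carrier G", OF eq] by (simp add: ell2_def)
  show "(\<Sum>\<^sub>\<infinity>x\<in>carrier G. (cmod (left_translate G g f x))\<^sup>2) = (\<Sum>\<^sub>\<infinity>x\<in>carrier G. (cmod (f x))\<^sup>2)"
    using infsum_reindex_bij_betw[OF bij, of "\<lambda>x. (cmod (f x))\<^sup>2"] infsum_cong[of "carrier G", OF eq] by simp
qed

lemma (in group) left_regular_bound: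
  assumes a: "a \<in> group_algebra G" and f: "f \<in> ell2 G"
  shows "left_regular G a f \<in> ell2 G"
    and "ell2_norm G (left_regular G a f)
      \<le> sqrt ((\<Sum>g | a g \<noteq> 0. (cmod (a g))\<^sup>2) * real (card {g. a g \<noteq> 0})) * ell2_norm G f"
proof -
  let ?A = "{g. a g \<noteq> 0}"
  let ?K = "\<Sum>g\<in>?A. (cmod (a g))\<^sup>2"
  let ?h = "\<lambda>x. ?K * (\<Sum>g\<in>?A. (cmod (left_translate G g f x))\<^sup>2)"
  have fin: "finite ?A" and sub: "?A \<subseteq> carrier G" using a by (auto simp: group_algebra_def)
  have bd: "(cmod (left_regular G a f x))\<^sup>2 \<le> ?h x" for x
  proof -
    have "cmod (left_regular G a f x) \<le> (\<Sum>g\<in>?A. cmod (a g) * cmod (left_translate G g f x))"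
      unfolding left_regular_def by (rule order_trans[OF norm_sum]) (simp add: norm_mult)
    then have "(cmod (left_regular G a f x))\<^sup>2
        \<le> (\<Sum>g\<in>?A. cmod (a g) * cmod (left_translate G g f x))\<^sup>2"
      by (rule power_mono) simp
    also have "\<dots> \<le> ?h x" by (rule Cauchy_Schwarz_ineq_sum)
    finally show ?thesis .
  qed
  have hs: "((\<lambda>x. \<Sum>g\<in>B. (cmod (left_translate G g f x))\<^sup>2) has_sum
      (\<Sum>g\<in>B. \<Sum>\<^sub>\<infinity>x\<in>carrier G. (cmod (f x))\<^sup>2)) (carrier G)"
    if "finite B" "B \<subseteq> carrier G" for B
    using that
  proof (induction B rule: finite_induct)
    case (insert g B)
    then have "((\<lambda>x. (cmod (left_translate G g f x))\<^sup>2) has_sum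
        (\<Sum>\<^sub>\<infinity>x\<in>carrier G. (cmod (f x))\<^sup>2)) (carrier G)"
      using left_translate_norm[OF _ f, of g] has_sum_infsum by fastforce
    then show ?case using insert by (simp add: has_sum_add del: sum_constant)
  qed simp
  have sumh: "(\<lambda>x. \<Sum>g\<in>?A. (cmod (left_translate G g f x))\<^sup>2) summable_on carrier G"
    using hs[OF fin sub] by (rule has_sum_imp_summable)
  then have summ: "?h summable_on carrier G" by (rule summable_on_cmult_right)
  have s: "(\<lambda>x. (cmod (left_regular G a f x))\<^sup>2) summable_on carrier G"
    by (rule summable_on_comparison_test[OF summ]) (use bd in auto)
  then show "left_regular G a f \<in> ell2 G"
    by (auto simp: ell2_def left_regular_def left_translate_def)
  have "(\<Sum>\<^sub>\<infinity>x\<in>carrier G. (cmod (left_regular G a f x))\<^sup>2) \<le> (\<Sum>\<^sub>\<infinity>x\<in>carrier G. ?h x)"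
    by (rule infsum_mono[OF s summ bd])
  also have "\<dots> = ?K * (\<Sum>\<^sub>\<infinity>x\<in>carrier G. \<Sum>g\<in>?A. (cmod (left_translate G g f x))\<^sup>2)"
    by (rule infsum_cmult_right) (rule sumh)
  also have "(\<Sum>\<^sub>\<infinity>x\<in>carrier G. \<Sum>g\<in>?A. (cmod (left_translate G g f x))\<^sup>2)
      = (\<Sum>g\<in>?A. \<Sum>\<^sub>\<infinity>x\<in>carrier G. (cmod (f x))\<^sup>2)"
    by (rule infsumI[OF hs[OF fin sub]])
  finally have "(\<Sum>\<^sub>\<infinity>x\<in>carrier G. (cmod (left_regular G a f x))\<^sup>2)
      \<le> ?K * real (card ?A) * (\<Sum>\<^sub>\<infinity>x\<in>carrier G. (cmod (f x))\<^sup>2)"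
    by (simp add: mult.assoc)
  then show "ell2_norm G (left_regular G a f) \<le> sqrt (?K * real (card ?A)) * ell2_norm G f"
    unfolding ell2_norm_def real_sqrt_mult[symmetric] by (rule real_sqrt_le_mono)
qed

lemma (in group) bdd_above_left_regular:
  assumes a: "a \<in> group_algebra G"
  shows "bdd_above ((\<lambda>f. ell2_norm G (left_regular G a f)) ` {f \<in> ell2 G. ell2_norm G f \<le> 1})"
proof (rule bdd_aboveI2)
  fix f assume f: "f \<in> {f \<in> ell2 G. ell2_norm G f \<le> 1}"
  let ?C = "sqrt ((\<Sum>g | a g \<noteq> 0. (cmod (a g))\<^sup>2) * real (card {g. a g \<noteq> 0}))"
  have "0 \<le> ?C" by (simp add: sum_nonneg)
  then have "?C * ell2_norm G f \<le> ?C" using f by (intro mult_left_le) auto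
  then show "ell2_norm G (left_regular G a f) \<le> ?C"
    using left_regular_bound(2)[OF a, of f] f by simp
qed

end

theory Submission
  imports Defs "HOL-Real_Asymp.Real_Asymp"
begin

text \<open>
  Write \<open>s\<^sub>n\<close> for the number of elements of length \<open>n\<close> and put \<open>\<phi> x = s\<^sub>n powr (- 1/2)\<close> for
  \<open>n = |x|\<close>. Summing \<open>\<phi> (g\<inverse> x)\<close> over the sphere \<open>|g| = k\<close>, the elements \<open>g\<close> whose Gromov product
  with \<open>x\<close> is about \<open>j\<close> number about \<open>s\<^bsub>k-j\<^esub>\<close>, and each contributes about
  \<open>(s\<^bsub>k-j\<^esub> s\<^bsub>n-j\<^esub>) powr (- 1/2)\<close>. Since \<open>s\<^sub>m s\<^sub>n\<close> and \<open>s\<^bsub>m+n\<^esub>\<close> agree up to a constant, every \<open>j \<le> k\<close> contributes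
  about \<open>sqrt s\<^sub>k \<cdot> \<phi> x\<close>, so \<open>\<phi>\<close> is almost an eigenfunction of \<open>\<sigma>\<^sub>k\<close> with eigenvalue about
  \<open>(k + 1) sqrt s\<^sub>k\<close>. The upper bound is then Schur's test with weight \<open>\<phi>\<close>, the lower bound comes from
  testing on the restriction of \<open>\<phi>\<close> to a large ball. Both counts rest on a finite set of connecting
  elements \<open>f\<close> such that for any \<open>u\<close>, \<open>w\<close> some product \<open>u f w\<close> has almost no cancellation; it consists of
  powers \<open>g\<^sup>n\<close>, \<open>g\<^bsup>-n\<^esup>\<close> of an element of infinite order and their conjugates by an element far from
  the axis of \<open>g\<close>, which exists because the group is not virtually cyclic.
\<close>

section \<open>Hyperbolicity under bilipschitz changes of a geodesic metric\<close>

text \<open>The weight \<open>\<phi>\<close> has mass one on every sphere, hence is not square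
  summable: it can serve directly as a Schur weight, but has to be cut off to become a test vector.
  The cutoff costs only a fixed factor, because mass is then counted by radii and not by group
  elements. The lower eigenvalue inequality is available only for k at most |x|, so the estimate has
  to avoid the centre of the ball as well as its boundary. The same weight serves every k; with
  nonnegative coefficients the inequalities for the single spheres therefore add up, and this
  produces the sum over k in both bounds.

  Submultiplicativity of the sphere sizes holds in every group; only the reverse inequality, up to a
  constant, needs the geometry. A further obstacle are dead ends, elements that no generator
  lengthens: a prescribed length can be reached only after a bounded correction. Finally,
  hyperbolicity is assumed for some generating set, whereas the spheres are those of
  \<open>S\<close>, so it first has to be carried over to the word metric of
  \<open>S\<close>.\<close>

locale discrete_geodesic_space =
  fixes M :: "'a set" and d :: "'a \<Rightarrow> 'a \<Rightarrow> real"
  assumes d_eq_0: "x \<in> M \<Longrightarrow> y \<in> M \<Longrightarrow> d x y = 0 \<longleftrightarrow> x = y"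
    and d_sym: "x \<in> M \<Longrightarrow> y \<in> M \<Longrightarrow> d x y = d y x"
    and d_tri: "x \<in> M \<Longrightarrow> y \<in> M \<Longrightarrow> z \<in> M \<Longrightarrow> d x z \<le> d x y + d y z"
    and d_nat: "x \<in> M \<Longrightarrow> y \<in> M \<Longrightarrow> \<exists>n. d x y = real n"
    and d_between: "x \<in> M \<Longrightarrow> y \<in> M \<Longrightarrow> real t \<le> d x y
      \<Longrightarrow> \<exists>z\<in>M. d x z = real t \<and> d z y = d x y - real t"
begin

abbreviation gp :: "'a \<Rightarrow> 'a \<Rightarrow> 'a \<Rightarrow> real" where
  "gp \<equiv> gromov_product d"

lemma d_nonneg: "x \<in> M \<Longrightarrow> y \<in> M \<Longrightarrow> 0 \<le> d x y"
  using d_nat[of x y] by auto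

lemma gp_sym: "x \<in> M \<Longrightarrow> y \<in> M \<Longrightarrow> gp w x y = gp w y x"
  by (simp add: gromov_product_def d_sym)

lemma gp_nonneg: "w \<in> M \<Longrightarrow> x \<in> M \<Longrightarrow> y \<in> M \<Longrightarrow> 0 \<le> gp w x y"
  using d_tri[of x w y] d_sym[of w y] by (simp add: gromov_product_def)

lemma gp_self: "x \<in> M \<Longrightarrow> gp w x x = d x w"
  by (simp add: gromov_product_def d_eq_0)

lemma gp_le_dist: "w \<in> M \<Longrightarrow> x \<in> M \<Longrightarrow> y \<in> M \<Longrightarrow> gp w x y \<le> d x w"
  using d_tri[of y x w] d_sym[of y x] by (simp add: gromov_product_def)

lemma gp_change_arg:
  "w \<in> M \<Longrightarrow> x \<in> M \<Longrightarrow> y \<in> M \<Longrightarrow> y' \<in> M \<Longrightarrow> gp w x y \<le> gp w x y' + d y y'"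
  using d_tri[of y y' w] d_tri[of x y y'] d_sym[of y y'] d_tri[of x y' y] by (simp add: gromov_product_def field_simps)

lemma gp_change_base:
  "w \<in> M \<Longrightarrow> w' \<in> M \<Longrightarrow> x \<in> M \<Longrightarrow> y \<in> M \<Longrightarrow> gp w x y \<le> gp w' x y + d w w'"
  using d_tri[of x w' w] d_tri[of y w' w] d_sym[of w w'] by (simp add: gromov_product_def field_simps)

lemma gp_ge_dist: "w \<in> M \<Longrightarrow> x \<in> M \<Longrightarrow> y \<in> M \<Longrightarrow> gp w x y \<ge> d x w - d x y"
  using d_tri[of x y w] by (simp add: gromov_product_def)

lemma path_length:
  assumes "\<forall>i\<le>n. p i \<in> M" "\<forall>i<n. d (p i) (p (Suc i)) \<le> c" "i \<le> j" "j \<le> n"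
  shows "d (p i) (p j) \<le> c * (real j - real i)"
  using assms(3,4)
proof (induction j)
  case 0
  then show ?case using assms(1) d_eq_0[of "p 0" "p 0"] by auto
next
  case (Suc j)
  show ?case
  proof (cases "i = Suc j")
    case True
    then show ?thesis using assms(1) Suc.prems d_eq_0[of "p i" "p i"] by auto
  next
    case False
    then have ij: "i \<le> j" "j < n" using Suc.prems by auto
    have "d (p i) (p (Suc j)) \<le> d (p i) (p j) + d (p j) (p (Suc j))"
      using assms(1) Suc.prems by (intro d_tri) auto
    also have "\<dots> \<le> c * (real j - real i) + c"
      using Suc.IH assms(2) ij by (intro add_mono) auto
    finally show ?thesis by (simp add: algebra_simps)
  qed
qed

lemma geodesic_path:
  assumes "x \<in> M" "y \<in> M"
  obtains p n where "p 0 = x" "p n = y" "\<forall>i\<le>n. p i \<in> M" "\<forall>i<n. d (p i) (p (Suc i)) = 1"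
    "\<And>i j. i \<le> j \<Longrightarrow> j \<le> n \<Longrightarrow> d (p i) (p j) = real j - real i"
proof -
  obtain n where n: "d x y = real n" using d_nat assms by blast
  have "\<exists>p. p 0 = x \<and> p n = y \<and> (\<forall>i\<le>n. p i \<in> M) \<and> (\<forall>i<n. d (p i) (p (Suc i)) = 1)"
    using assms n
  proof (induction n arbitrary: y)
    case 0
    then show ?case using d_eq_0 by (intro exI[of _ "\<lambda>_. x"]) auto
  next
    case (Suc n)
    then obtain z where z: "z \<in> M" "d x z = real n" "d z y = 1"
      using d_between[of x y n] by auto
    then obtain p where p: "p 0 = x" "p n = z" "\<forall>i\<le>n. p i \<in> M" "\<forall>i<n. d (p i) (p (Suc i)) = 1"
      using Suc.IH[of z] Suc.prems by auto
    show ?case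
      by (rule exI[of _ "p(Suc n := y)"]) (use p z Suc.prems in \<open>auto simp: less_Suc_eq le_Suc_eq\<close>)
  qed
  then obtain p where p: "p 0 = x" "p n = y" "\<forall>i\<le>n. p i \<in> M" "\<forall>i<n. d (p i) (p (Suc i)) = 1"
    by blast
  have len: "d (p i) (p j) \<le> real j - real i" if "i \<le> j" "j \<le> n" for i j
    using path_length[of n p 1 i j] p that by auto
  have "d (p i) (p j) = real j - real i" if ij: "i \<le> j" "j \<le> n" for i j
  proof -
    have "real n \<le> d (p 0) (p i) + d (p i) (p n)"
      using d_tri[of "p 0" "p i" "p n"] p n ij by auto
    also have "d (p i) (p n) \<le> d (p i) (p j) + d (p j) (p n)"
      using p ij by (intro d_tri) auto
    finally show ?thesis using len[of 0 i] len[of j n] len[of i j] ij by auto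
  qed
  then show thesis using p that by blast
qed

end

section \<open>Four-point hyperbolicity: chains, near geodesics and centers of triangles\<close>

locale hyperbolic_space = discrete_geodesic_space M d for M :: "'a set" and d +
  fixes \<delta> :: real
  assumes delta_nonneg: "0 \<le> \<delta>"
    and hyp: "w \<in> M \<Longrightarrow> x \<in> M \<Longrightarrow> y \<in> M \<Longrightarrow> z \<in> M
      \<Longrightarrow> min (gromov_product d w x y) (gromov_product d w y z) - \<delta> \<le> gromov_product d w x z"
begin

text \<open>Bisection: every level uses the four-point inequality once, so a chain of
  \<open>2 ^ k\<close> steps loses only \<open>k * \<delta>\<close>. The lower bound on
  \<open>d (p i) w\<close> covers chains without steps, whose Gromov product is a distance.\<close>

lemma log_chain:
  assumes w: "w \<in> M" and "n \<le> 2 ^ k" "\<forall>i\<le>n. p i \<in> M" "\<forall>i\<le>n. c \<le> d (p i) w"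
    "\<forall>i<n. c \<le> gp w (p i) (p (Suc i))"
  shows "c - real k * \<delta> \<le> gp w (p 0) (p n)"
  using assms(2-)
proof (induction k arbitrary: n p)
  case 0
  then consider "n = 0" | "n = 1" by force
  then show ?case using 0 by cases (auto simp: gp_self)
next
  case (Suc k)
  define m where "m = n div 2"
  have m: "m \<le> 2 ^ k" "n - m \<le> 2 ^ k" "m \<le> n" using Suc.prems(1) by (auto simp: m_def)
  have 1: "c - real k * \<delta> \<le> gp w (p 0) (p m)"
    using Suc.prems m by (intro Suc.IH) auto
  have "c - real k * \<delta> \<le> gp w (p (0 + m)) (p (n - m + m))"
    using Suc.prems m by (intro Suc.IH[where p = "\<lambda>i. p (i + m)"]) auto
  then have "c - real k * \<delta> \<le> gp w (p m) (p n)" using m by simp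
  then show ?case
    using 1 hyp[of w "p 0" "p m" "p n"] w Suc.prems(2) m(3) by (auto simp: algebra_simps min_def split: if_splits)
qed

lemma log_chain_segment:
  assumes "w \<in> M" "\<forall>i\<le>n. p i \<in> M" "\<forall>i\<le>n. c \<le> d (p i) w" "\<forall>i<n. c \<le> gp w (p i) (p (Suc i))"
    "i \<le> n" "j \<le> n" "\<bar>int i - int j\<bar> \<le> 2 ^ k"
  shows "c - real k * \<delta> \<le> gp w (p i) (p j)"
proof -
  have *: "c - real k * \<delta> \<le> gp w (p i) (p j)" if ij: "i \<le> j" "j \<le> n" "int j - int i \<le> 2 ^ k" for i j
  proof -
    have "int (j - i) \<le> int (2 ^ k)" using ij by (simp add: of_nat_diff)
    then have k: "j - i \<le> 2 ^ k" by (simp only: of_nat_le_iff)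
    have "c - real k * \<delta> \<le> gp w (p (0 + i)) (p (j - i + i))"
      by (rule log_chain[where p = "\<lambda>t. p (t + i)"]) (use assms ij k in auto)
    then show ?thesis using ij by simp
  qed
  show ?thesis
    using *[of i j] *[of j i] assms gp_sym[of "p i" "p j" w] by (cases "i \<le> j") auto
qed

text \<open>Take \<open>q\<close> as far from \<open>x\<close> as \<open>c\<close> is, or
  \<open>q = y\<close> if \<open>c\<close> is farther away than \<open>y\<close>. Then
  \<open>gp c x q\<close> and \<open>gp c q y\<close> are both at least half of
  \<open>d c q\<close>, and the four-point inequality bounds their minimum by
  \<open>K + \<delta>\<close>.\<close>

lemma near_geodesic_point:
  assumes "x \<in> M" "y \<in> M" "c \<in> M" "gp c x y \<le> K"
  obtains q where "q \<in> M" "d x q + d q y = d x y" "d c q \<le> 2 * (K + \<delta>)"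
proof -
  obtain t s where t: "d x c = real t" and s: "d x y = real s" using d_nat assms by meson
  have "real (min t s) \<le> d x y" using s by auto
  then obtain q where q: "q \<in> M" "d x q = real (min t s)" "d q y = d x y - real (min t s)"
    using d_between assms by blast
  have sy: "d c q = d q c" "d c y = d y c" "d x c = d c x" "d y q = d q y" using d_sym q assms by auto
  have "d q c / 2 \<le> gp c x q" using q sy t by (simp add: gromov_product_def min_def)
  moreover have "d q c / 2 \<le> gp c q y"
    using q sy t s d_tri[of x c y] d_nonneg[of c y] assms by (auto simp: gromov_product_def min_def)
  ultimately have "d q c / 2 \<le> min (gp c x q) (gp c q y)" by simp
  then have "d q c / 2 - \<delta> \<le> gp c x y"
    using hyp[OF assms(3,1) q(1) assms(2)] by (rule order_trans[OF diff_right_mono])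
  then have "d c q \<le> 2 * (K + \<delta>)" using assms(4) sy(1) by (simp add: field_simps)
  then show thesis using that q by auto
qed

text \<open>The branch point of the tripod spanned by \<open>x\<close>, \<open>y\<close>,
  \<open>z\<close>: the point between \<open>x\<close> and \<open>y\<close> whose distance from
  \<open>x\<close> is \<open>gp x y z\<close>, rounded down. The rounding accounts for the summand
  1.\<close>

lemma center:
  assumes "x \<in> M" "y \<in> M" "z \<in> M"
  obtains c where "c \<in> M" "gp c x y \<le> 1 + \<delta>" "gp c y z \<le> 1 + \<delta>" "gp c x z \<le> 1 + \<delta>"
proof -
  define t where "t = nat \<lfloor>gp x y z\<rfloor>"
  have t: "real t \<le> gp x y z" "gp x y z < real t + 1"
    using gp_nonneg[of x y z] assms by (auto simp: t_def)
  then have "real t \<le> d x y" using gp_le_dist[of x y z] d_sym[of x y] assms by auto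
  then obtain c where c: "c \<in> M" "d x c = real t" "d c y = d x y - real t"
    using d_between assms by blast
  have sy: "d y c = d c y" "d y x = d x y" "d z x = d x z" "d z c = d c z" "d x c = d c x" "d z y = d y z"
    using d_sym c assms by auto
  have "gp x c y = real t" using c sy by (simp add: gromov_product_def)
  then have h: "real t - \<delta> \<le> gp x c z"
    using hyp[OF assms(1) c(1) assms(2,3)] t by linarith
  have "gp c x y \<le> 1 + \<delta>" "gp c y z \<le> 1 + \<delta>" "gp c x z \<le> 1 + \<delta>"
    using h t c sy delta_nonneg by (auto simp: gromov_product_def field_simps)
  then show thesis using that c by auto
qed

end

text \<open>The numerical contradiction behind \<open>near_quasigeodesic\<close>: about
  \<open>log 2 m\<close> bisections suffice for a chain of \<open>6 * L * m\<close> steps, and their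
  total loss stays below \<open>m\<close> once \<open>m\<close> is large.\<close>

lemma log_growth_bound:
  fixes L \<delta> :: real
  assumes "0 < L"
  shows "\<exists>D::nat. \<forall>m::nat. D \<le> m \<longrightarrow> (\<exists>k. 6 * L * real m \<le> 2 ^ k \<and> L / 2 + (real k + 2) * \<delta> < real m)"
proof -
  define \<epsilon> where "\<epsilon> = \<bar>\<delta>\<bar> + 1"
  have "\<epsilon> > 0" by (auto simp: \<epsilon>_def)
  then have "eventually (\<lambda>m::nat. L / 2 + (log 2 (6 * L * real m) + 3) * \<epsilon> < real m) at_top"
    using assms by real_asymp
  then obtain D where D: "\<And>m. D \<le> m \<Longrightarrow> L / 2 + (log 2 (6 * L * real m) + 3) * \<epsilon> < real m"
    by (auto simp: eventually_at_top_linorder)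
  have "\<exists>k. 6 * L * real m \<le> 2 ^ k \<and> L / 2 + (real k + 2) * \<delta> < real m"
    if m: "nat \<lceil>1 / (6 * L)\<rceil> + D + 1 \<le> m" for m
  proof -
    have "1 / (6 * L) \<le> real m" using m by linarith
    then have ge1: "1 \<le> 6 * L * real m" using assms by (simp add: field_simps)
    define k where "k = nat \<lceil>log 2 (6 * L * real m)\<rceil>"
    have lg: "0 \<le> log 2 (6 * L * real m)" using ge1 by simp
    have k: "log 2 (6 * L * real m) \<le> real k" "real k \<le> log 2 (6 * L * real m) + 1"
      using lg unfolding k_def by linarith+
    have "6 * L * real m = 2 powr log 2 (6 * L * real m)" using ge1 by simp
    also have "\<dots> \<le> 2 powr real k" using k by (intro powr_mono) auto
    also have "\<dots> = 2 ^ k" by (simp add: powr_realpow)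
    finally have 1: "6 * L * real m \<le> 2 ^ k" .
    have "(real k + 2) * \<delta> \<le> (real k + 2) * \<epsilon>" by (intro mult_left_mono) (auto simp: \<epsilon>_def)
    also have "\<dots> \<le> (log 2 (6 * L * real m) + 3) * \<epsilon>"
      using k \<open>\<epsilon> > 0\<close> by (intro mult_right_mono) auto
    finally show ?thesis using 1 D[of m] m by (intro exI[of _ k]) auto
  qed
  then show ?thesis by blast
qed

text \<open>Let \<open>w\<close> be a point of the geodesic at maximal distance \<open>m\<close> from \<open>p\<close>. Moving \<open>2 m\<close> away from \<open>w\<close>
  on both sides and joining the two points along \<open>p\<close> gives a chain of \<open>O(m)\<close> steps outside the
  \<open>m\<close>-ball around \<open>w\<close>, which \<open>log_chain\<close> forbids once \<open>m\<close> exceeds a logarithm of its length.\<close>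

lemma (in hyperbolic_space) near_quasigeodesic:
  assumes L: "0 < L"
  obtains D where "\<And>n p c. \<forall>i\<le>n. p i \<in> M \<Longrightarrow> \<forall>i<n. d (p i) (p (Suc i)) \<le> L
    \<Longrightarrow> \<forall>i\<le>n. \<forall>j\<le>n. \<bar>real i - real j\<bar> \<le> L * d (p i) (p j)
    \<Longrightarrow> c \<in> M \<Longrightarrow> d (p 0) c + d c (p n) = d (p 0) (p n) \<Longrightarrow> \<exists>i\<le>n. d c (p i) \<le> D"
proof -
  obtain D :: nat where D: "\<And>m. D \<le> m \<Longrightarrow> \<exists>k. 6 * L * real m \<le> 2 ^ k \<and> L / 2 + (real k + 2) * \<delta> < real m"
    using log_growth_bound[OF L] by blast
  have "\<exists>i\<le>n. d c (p i) \<le> real D"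
    if p: "\<forall>i\<le>n. p i \<in> M" and step: "\<forall>i<n. d (p i) (p (Suc i)) \<le> L"
      and qg: "\<forall>i\<le>n. \<forall>j\<le>n. \<bar>real i - real j\<bar> \<le> L * d (p i) (p j)"
      and c: "c \<in> M" "d (p 0) c + d c (p n) = d (p 0) (p n)" for n p c
  proof -
    \<comment> \<open>\<open>B\<close> holds for the points on any geodesic between the two ends, so
      no geodesic has to be fixed and points constructed from a maximal \<open>w\<close> satisfy
      \<open>B\<close> again.\<close>
    define B where "B = (\<lambda>c. c \<in> M \<and> d (p 0) c + d c (p n) = d (p 0) (p n))"
    define \<mu> where "\<mu> c = (LEAST m. \<exists>i\<le>n. d c (p i) \<le> real m)" for c
    have ex: "\<exists>m. \<exists>i\<le>n. d c (p i) \<le> real m" for c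
      using real_arch_simple[of "d c (p 0)"] by blast
    have \<mu>: "\<exists>i\<le>n. d c (p i) \<le> real (\<mu> c)" for c
      using LeastI_ex[OF ex[of c]] by (simp add: \<mu>_def)
    have \<mu>_ge: "real (\<mu> c) \<le> d c (p i)" if "c \<in> M" "i \<le> n" for c i
    proof -
      obtain m where m: "d c (p i) = real m" using d_nat p \<open>c \<in> M\<close> \<open>i \<le> n\<close> by blast
      then have "\<mu> c \<le> m" unfolding \<mu>_def using \<open>i \<le> n\<close> by (intro Least_le) auto
      then show ?thesis using m by simp
    qed
    obtain N where N: "d (p 0) (p n) = real N" using d_nat p by blast
    have "\<mu> c < Suc N" if "B c" for c
    proof -
      have "real (\<mu> c) \<le> d c (p 0)" using \<mu>_ge[of c 0] that by (auto simp: B_def)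
      also have "\<dots> \<le> real N"
        using that N p d_sym[of c "p 0"] d_nonneg[of c "p n"] by (auto simp: B_def)
      finally show ?thesis by simp
    qed
    moreover have "B c" using c by (simp add: B_def)
    ultimately obtain w where w: "B w" and max: "\<And>c. B c \<Longrightarrow> \<mu> c \<le> \<mu> w"
      using ex_has_greatest_nat[of B c \<mu> "Suc N"] by blast
    define m where "m = \<mu> w"
    have wM: "w \<in> M" and wb: "d (p 0) w + d w (p n) = d (p 0) (p n)" using w by (auto simp: B_def)
    have p0n: "p 0 \<in> M" "p n \<in> M" using p by auto
    \<comment> \<open>At distance \<open>2 * m\<close> from \<open>w\<close>, a point within
      \<open>m\<close> of \<open>p i\<close> has product at least
      \<open>(2 * m + m - m) / 2 = m\<close> with it, since \<open>p i\<close> is itself at least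
      \<open>m\<close> away from \<open>w\<close>. If the end \<open>z\<close> is closer than
      \<open>2 * m\<close>, then \<open>z\<close> itself is a point of \<open>p\<close> and is used
      instead.\<close>
    have half: "\<exists>y i. i \<le> n \<and> y \<in> M \<and> d y (p i) \<le> real m \<and> real m \<le> gp w y (p i)
        \<and> d w y \<le> 2 * real m \<and> d w y + d y z = d w z"
      if z: "z = p 0 \<or> z = p n" for z
    proof (cases "2 * real m \<le> d w z")
      case True
      have zM: "z \<in> M" using z p0n by auto
      obtain y where y: "y \<in> M" "d w y = 2 * real m" "d y z = d w z - 2 * real m"
        using d_between[OF wM zM, of "2 * m"] True by auto
      have "B y"
        using z wb y p0n wM d_tri[of "p 0" y "p n"] d_tri[of "p 0" w y] d_tri[of y w "p n"]
          d_sym[of "p 0" y] d_sym[of "p 0" w] d_sym[of w y]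
        by (auto simp: B_def)
      then obtain i where i: "i \<le> n" "d y (p i) \<le> real m"
        using max[of y] \<mu>[of y] by (force simp: m_def)
      have "real m \<le> d w (p i)" using \<mu>_ge[of w i] wM i by (simp add: m_def)
      then have "real m \<le> gp w y (p i)"
        using i y d_sym[of w y] d_sym[of w "p i"] wM p by (auto simp: gromov_product_def)
      then show ?thesis using i y by (intro exI[of _ y] exI[of _ i]) auto
    next
      case False
      have "\<exists>i\<le>n. z = p i" using z by auto
      then obtain i where i: "i \<le> n" "z = p i" by blast
      have "real m \<le> d w (p i)" using \<mu>_ge[of w i] wM i by (simp add: m_def)
      then have "real m \<le> gp w z (p i)" using i wM p d_sym[of w z] gp_self by auto
      then show ?thesis using False i p d_eq_0[of z z] by (intro exI[of _ z] exI[of _ i]) auto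
    qed
    obtain y i where y: "i \<le> n" "y \<in> M" "d y (p i) \<le> real m" "real m \<le> gp w y (p i)"
      "d w y \<le> 2 * real m" "d w y + d y (p 0) = d w (p 0)"
      using half[of "p 0"] by blast
    obtain y' j where y': "j \<le> n" "y' \<in> M" "d y' (p j) \<le> real m" "real m \<le> gp w y' (p j)"
      "d w y' \<le> 2 * real m" "d w y' + d y' (p n) = d w (p n)"
      using half[of "p n"] by blast
    have pij: "p i \<in> M" "p j \<in> M" using p y y' by auto
    \<comment> \<open>The points \<open>y\<close> and \<open>y'\<close> lie on opposite sides of
      \<open>w\<close>, so their product at \<open>w\<close> vanishes. For large \<open>m\<close>
      the chain \<open>y\<close>, \<open>p i\<close>, \<open>p j\<close>, \<open>y'\<close> would
      force it to be at least \<open>m - L / 2 - (k + 2) * \<delta> > 0\<close>.\<close>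
    have yy': "d y y' = d w y + d w y'"
      using d_tri[of y w y'] d_tri[of "p 0" y "p n"] d_tri[of y y' "p n"] d_sym[of y w] d_sym[of "p 0" y]
        d_sym[of "p 0" w] wb y y' wM p0n by auto
    then have zero: "gp w y y' = 0"
      using d_sym[of y w] d_sym[of y' w] y y' wM by (auto simp: gromov_product_def)
    have "m < D"
    proof (rule ccontr)
      assume "\<not> m < D"
      then obtain k where k: "6 * L * real m \<le> 2 ^ k" "L / 2 + (real k + 2) * \<delta> < real m" using D[of m] by auto
      \<comment> \<open>The detour through \<open>y\<close>, \<open>w\<close> and \<open>y'\<close>
        has length at most \<open>m + 2 * m + 2 * m + m\<close>.\<close>
      have "d (p i) (p j) \<le> 6 * real m"
        using d_tri[OF pij(1) y(2) pij(2)] d_tri[OF y(2) y'(2) pij(2)] d_sym[OF pij(1) y(2)] yy' y(3,5) y'(3,5)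
        by linarith
      then have "L * d (p i) (p j) \<le> 6 * L * real m" using L by simp
      then have "\<bar>real i - real j\<bar> \<le> 2 ^ k" using qg y(1) y'(1) k(1) by fastforce
      then have "real_of_int \<bar>int i - int j\<bar> \<le> real_of_int (2 ^ k)" by simp
      then have ij: "\<bar>int i - int j\<bar> \<le> 2 ^ k" by (simp only: of_int_le_iff)
      have mp: "real m \<le> d (p i) w" if "i \<le> n" for i
        using \<mu>_ge[of w i] wM p that d_sym[of w "p i"] by (simp add: m_def)
      have "real m - L / 2 \<le> gp w (p i) (p (Suc i))" if "i < n" for i
      proof -
        have "real m \<le> d (p i) w" "real m \<le> d (p (Suc i)) w" using mp that by auto
        then show ?thesis using step that by (auto simp: gromov_product_def field_simps intro: add_mono)
      qed
      moreover have "real m - L / 2 \<le> d (p i) w" if "i \<le> n" for i using mp[OF that] L by simp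
      ultimately have ch: "real m - L / 2 - real k * \<delta> \<le> gp w (p i) (p j)"
        using log_chain_segment[OF wM p, of "real m - L / 2" i j k] y(1) y'(1) ij by auto
      define b where "b = real m - L / 2 - real k * \<delta>"
      have b: "b \<le> real m" "b \<le> gp w (p i) (p j)"
        using ch L delta_nonneg mult_nonneg_nonneg[of "real k" \<delta>] unfolding b_def by linarith+
      have "b \<le> min (gp w y (p i)) (gp w (p i) (p j))" using b y(4) by auto
      then have "b - \<delta> \<le> gp w y (p j)" using hyp[OF wM y(2) pij] by linarith
      moreover have "b - \<delta> \<le> gp w (p j) y'"
        using b(1) y'(4) delta_nonneg gp_sym[OF y'(2) pij(2)] by simp
      ultimately have "b - \<delta> \<le> min (gp w y (p j)) (gp w (p j) y')" by simp
      then have "real m - L / 2 - real k * \<delta> - 2 * \<delta> \<le> gp w y y'"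
        using hyp[OF wM y(2) pij(2) y'(2)] b_def by linarith
      then show False using zero k(2) by (simp add: algebra_simps)
    qed
    moreover obtain i where "i \<le> n" "d c (p i) \<le> real (\<mu> c)" using \<mu>[of c] by blast
    ultimately show ?thesis using max[OF \<open>B c\<close>] unfolding m_def by (intro exI[of _ i]) auto
  qed
  then show thesis using that by blast
qed

text \<open>Upper bounds on Gromov products pass from \<open>d\<close> to \<open>e\<close> (this is
  \<open>tr\<close>): a geodesic of \<open>e\<close> is a quasi-geodesic of \<open>d\<close> and so
  comes close to every point at which the product of its ends is small. Upper bounds suffice once
  products are based at a \<open>d\<close>-center \<open>c\<close> of \<open>w\<close>,
  \<open>x\<close>, \<open>z\<close>: there \<open>e.gp w x z\<close> is at least
  \<open>e w c - 2 * K\<close>, while one of the other two products is at most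
  \<open>e w c + K\<close>.\<close>

theorem (in hyperbolic_space) bilipschitz_invariance:
  assumes e: "discrete_geodesic_space M e" and L: "0 < L"
    and de: "\<And>x y. x \<in> M \<Longrightarrow> y \<in> M \<Longrightarrow> d x y \<le> L * e x y"
    and ed: "\<And>x y. x \<in> M \<Longrightarrow> y \<in> M \<Longrightarrow> e x y \<le> L * d x y"
  shows "gromov_hyperbolic M e"
proof -
  interpret e: discrete_geodesic_space M e by (rule e)
  obtain D where D: "\<And>n p c. \<forall>i\<le>n. p i \<in> M \<Longrightarrow> \<forall>i<n. d (p i) (p (Suc i)) \<le> L
    \<Longrightarrow> \<forall>i\<le>n. \<forall>j\<le>n. \<bar>real i - real j\<bar> \<le> L * d (p i) (p j)
    \<Longrightarrow> c \<in> M \<Longrightarrow> d (p 0) c + d c (p n) = d (p 0) (p n) \<Longrightarrow> \<exists>i\<le>n. d c (p i) \<le> D"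
    using near_quasigeodesic[OF L] by blast
  have tr: "e.gp c x y \<le> L * (2 * (K + \<delta>) + D)"
    if xy: "x \<in> M" "y \<in> M" "c \<in> M" and K: "gp c x y \<le> K" for x y c K
  proof -
    obtain q where q: "q \<in> M" "d x q + d q y = d x y" "d c q \<le> 2 * (K + \<delta>)"
      using near_geodesic_point[OF xy K] by blast
    obtain p n where p: "p 0 = x" "p n = y" "\<forall>i\<le>n. p i \<in> M" "\<forall>i<n. e (p i) (p (Suc i)) = 1"
      and pe: "\<And>i j. i \<le> j \<Longrightarrow> j \<le> n \<Longrightarrow> e (p i) (p j) = real j - real i"
      using e.geodesic_path[OF xy(1,2)] by metis
    have "\<forall>i<n. d (p i) (p (Suc i)) \<le> L" using de p by (metis Suc_leI less_imp_le mult.right_neutral)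
    moreover have "\<bar>real i - real j\<bar> \<le> L * d (p i) (p j)" if "i \<le> n" "j \<le> n" for i j
    proof (cases "i \<le> j")
      case True
      then show ?thesis using pe[of i j] ed[of "p i" "p j"] p that by auto
    next
      case False
      then show ?thesis using pe[of j i] ed[of "p j" "p i"] p that d_sym[of "p i" "p j"] by auto
    qed
    ultimately obtain i where i: "i \<le> n" "d q (p i) \<le> D"
      using D[of n p q] p q by auto
    have pi: "p i \<in> M" using p i by auto
    have "d c (p i) \<le> 2 * (K + \<delta>) + D" using d_tri[OF xy(3) q(1) pi] q i by linarith
    then have ec: "e c (p i) \<le> L * (2 * (K + \<delta>) + D)"
      using ed[OF xy(3) pi] L by (smt (verit) mult_left_mono)
    have "e x (p i) + e (p i) y = e x y"
      using pe[of 0 i] pe[of i n] pe[of 0 n] p i by auto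
    moreover have "e x c \<le> e x (p i) + e c (p i)" "e y c \<le> e (p i) y + e c (p i)"
      using e.d_tri[of x "p i" c] e.d_tri[of y "p i" c] e.d_sym[of c "p i"] e.d_sym[of y "p i"] xy pi by auto
    ultimately show ?thesis using ec by (simp add: gromov_product_def)
  qed
  \<comment> \<open>\<open>1 + 2 * \<delta>\<close> is the bound \<open>1 + \<delta>\<close> of
    \<open>center\<close> plus one \<open>\<delta>\<close> for the four-point inequality based at
    \<open>c\<close>.\<close>
  define K where "K = L * (2 * (1 + 2 * \<delta> + \<delta>) + D)"
  have "min (e.gp w x y) (e.gp w y z) - 3 * K \<le> e.gp w x z"
    if m: "w \<in> M" "x \<in> M" "y \<in> M" "z \<in> M" for w x y z
  proof -
    obtain c where c: "c \<in> M" "gp c w x \<le> 1 + \<delta>" "gp c x z \<le> 1 + \<delta>" "gp c w z \<le> 1 + \<delta>"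
      using center[OF m(1,2,4)] by blast
    have eK: "e.gp c u v \<le> K" if "u \<in> M" "v \<in> M" "gp c u v \<le> 1 + 2 * \<delta>" for u v
      using tr[OF that(1,2) c(1) that(3)] by (simp add: K_def)
    have 1: "e.gp c w x \<le> K" "e.gp c w z \<le> K" using eK m c delta_nonneg by auto
    have sy: "e x w = e w x" "e z w = e w z" "e y w = e w y" "e x c = e c x" "e z c = e c z" "e w c = e c w" "e z y = e y z"
      using e.d_sym m c by auto
    have K0: "0 \<le> K" using e.gp_nonneg[OF c(1) m(1,2)] 1 by simp
    have "e w c - 2 * K \<le> e.gp w x z"
      using 1 e.d_tri[OF m(2) c(1) m(4)] sy by (simp add: gromov_product_def field_simps)
    moreover have "gp c x y \<le> 1 + 2 * \<delta> \<or> gp c y z \<le> 1 + 2 * \<delta>"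
      using hyp[OF c(1) m(2,3,4)] c(3) by linarith
    then have "e.gp c x y \<le> K \<or> e.gp c y z \<le> K" using eK m by blast
    then have "min (e.gp w x y) (e.gp w y z) \<le> e w c + K"
    proof
      assume "e.gp c x y \<le> K"
      then have "e.gp w x y \<le> e w c + K"
        using e.gp_change_base[OF m(1) c(1) m(2,3)] by linarith
      then show ?thesis by linarith
    next
      assume "e.gp c y z \<le> K"
      then have "e.gp w y z \<le> e w c + K"
        using e.gp_change_base[OF m(1) c(1) m(3,4)] by linarith
      then show ?thesis by linarith
    qed
    ultimately show ?thesis by linarith
  qed
  then show ?thesis unfolding gromov_hyperbolic_def by blast
qed

section \<open>Word metrics\<close>

locale word_group = group G for G (structure) +
  fixes S :: "'a set"
  assumes gen: "fin_sym_gen_set G S"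
begin

abbreviation len :: "'a \<Rightarrow> nat" where
  "len \<equiv> word_length G S"

abbreviation dst :: "'a \<Rightarrow> 'a \<Rightarrow> real" where
  "dst \<equiv> word_dist G S"

lemma finite_S: "finite S" and S_carrier: "S \<subseteq> carrier G"
  and S_inv: "s \<in> S \<Longrightarrow> inv s \<in> S"
  using gen by (auto simp: fin_sym_gen_set_def)

lemma word_closed: "set ws \<subseteq> S \<Longrightarrow> foldr (\<otimes>) ws \<one> \<in> carrier G"
  using S_carrier by (induction ws) auto

lemma word_append:
  "set us \<subseteq> S \<Longrightarrow> set vs \<subseteq> S \<Longrightarrow> foldr (\<otimes>) (us @ vs) \<one> = foldr (\<otimes>) us \<one> \<otimes> foldr (\<otimes>) vs \<one>"
proof (induction us)
  case Nil
  then show ?case using word_closed by simp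
next
  case (Cons u us)
  then have "u \<in> carrier G" using S_carrier by auto
  then show ?case using Cons word_closed[of us] word_closed[of vs] by (simp add: m_assoc)
qed

lemma word_inv:
  "set us \<subseteq> S \<Longrightarrow> inv (foldr (\<otimes>) us \<one>) = foldr (\<otimes>) (map (\<lambda>s. inv s) (rev us)) \<one>"
proof (induction us)
  case (Cons u us)
  then have u: "u \<in> carrier G" "inv u \<in> S" using S_carrier S_inv by auto
  have "set (map (\<lambda>s. inv s) (rev us)) \<subseteq> S" using Cons.prems S_inv by auto
  then show ?case using Cons u word_closed[of us] word_append[of "map (\<lambda>s. inv s) (rev us)" "[inv u]"]
    by (simp add: inv_mult_group)
qed simp

lemma len_word_le: "set ws \<subseteq> S \<Longrightarrow> len (foldr (\<otimes>) ws \<one>) \<le> length ws"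
  unfolding word_length_def by (rule Least_le) blast

lemma geodesic_word:
  assumes "g \<in> carrier G"
  obtains ws where "set ws \<subseteq> S" "length ws = len g" "foldr (\<otimes>) ws \<one> = g"
proof -
  have "\<exists>n ws. set ws \<subseteq> S \<and> length ws = n \<and> foldr (\<otimes>) ws \<one> = g"
    using generate_imp_word[OF gen assms] by blast
  from LeastI_ex[OF this] show thesis using that unfolding word_length_def by blast
qed

lemma len_one [simp]: "len \<one> = 0"
  using len_word_le[of "[]"] by simp

lemma len_eq_0: "g \<in> carrier G \<Longrightarrow> len g = 0 \<longleftrightarrow> g = \<one>"
  by (metis geodesic_word foldr_Nil id_apply len_one length_0_conv)

lemma len_mult_le: "x \<in> carrier G \<Longrightarrow> y \<in> carrier G \<Longrightarrow> len (x \<otimes> y) \<le> len x + len y"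
  by (metis geodesic_word word_append len_word_le length_append set_append le_sup_iff)

lemma len_inv [simp]:
  assumes x: "x \<in> carrier G" shows "len (inv x) = len x"
proof -
  have *: "len (inv x) \<le> len x" if x: "x \<in> carrier G" for x
  proof -
    obtain ws where ws: "set ws \<subseteq> S" "length ws = len x" "foldr (\<otimes>) ws \<one> = x"
      using geodesic_word x by blast
    have "set (map (\<lambda>s. inv s) (rev ws)) \<subseteq> S" using ws S_inv by auto
    then show ?thesis using len_word_le[of "map (\<lambda>s. inv s) (rev ws)"] word_inv[OF ws(1)] ws by simp
  qed
  show ?thesis using *[of x] *[of "inv x"] x by simp
qed

lemma len_split:
  assumes g: "g \<in> carrier G" "t \<le> len g"
  obtains a b where "a \<in> carrier G" "b \<in> carrier G" "g = a \<otimes> b" "len a = t" "len b = len g - t"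
proof -
  obtain ws where ws: "set ws \<subseteq> S" "length ws = len g" "foldr (\<otimes>) ws \<one> = g"
    using geodesic_word g by blast
  define a b where "a = foldr (\<otimes>) (take t ws) \<one>" and "b = foldr (\<otimes>) (drop t ws) \<one>"
  have sub: "set (take t ws) \<subseteq> S" "set (drop t ws) \<subseteq> S"
    using ws(1) by (meson set_take_subset set_drop_subset subset_trans)+
  have ab: "a \<in> carrier G" "b \<in> carrier G" using word_closed sub by (auto simp: a_def b_def)
  have gab: "g = a \<otimes> b" using word_append[OF sub] ws(3) by (simp add: a_def b_def)
  have "len a \<le> t" "len b \<le> len g - t"
    using len_word_le[OF sub(1)] len_word_le[OF sub(2)] ws(2) g(2) by (auto simp: a_def b_def)
  moreover have "len g \<le> len a + len b" using len_mult_le ab gab by simp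
  ultimately show thesis using that[OF ab gab] g(2) by simp
qed

lemma finite_ball: "finite {g \<in> carrier G. len g \<le> n}"
proof -
  have "{g \<in> carrier G. len g \<le> n} \<subseteq> (\<lambda>ws. foldr (\<otimes>) ws \<one>) ` {ws. set ws \<subseteq> S \<and> length ws \<le> n}"
    using geodesic_word by (smt (verit, best) image_eqI mem_Collect_eq subsetI)
  moreover have "finite {ws. set ws \<subseteq> S \<and> length ws \<le> n}"
    using finite_lists_length_le[OF finite_S] by simp
  ultimately show ?thesis by (meson finite_imageI finite_subset)
qed

lemma dst_one: "x \<in> carrier G \<Longrightarrow> dst \<one> x = len x" "x \<in> carrier G \<Longrightarrow> dst x \<one> = len x"
  by (auto simp: word_dist_def)

lemma dst_mult_left [simp]:
  "g \<in> carrier G \<Longrightarrow> x \<in> carrier G \<Longrightarrow> y \<in> carrier G \<Longrightarrow> dst (g \<otimes> x) (g \<otimes> y) = dst x y"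
  by (simp add: word_dist_def inv_mult_group m_assoc inv_solve_left)
     (simp add: m_assoc[symmetric])

lemma dst_mult_right:
  "x \<in> carrier G \<Longrightarrow> y \<in> carrier G \<Longrightarrow> dst x (x \<otimes> y) = len y"
  by (simp add: word_dist_def m_assoc[symmetric])

sublocale discrete_geodesic_space "carrier G" "word_dist G S"
proof
  fix x y z t assume xy: "x \<in> carrier G" "y \<in> carrier G"
  show "(dst x y = 0) = (x = y)"
    using xy len_eq_0[of "inv x \<otimes> y"] by (auto simp: word_dist_def) (metis inv_equality inv_inv inv_closed r_inv)
  have "inv (inv x \<otimes> y) = inv y \<otimes> x" using xy by (simp add: inv_mult_group)
  then show "dst x y = dst y x" using xy len_inv[of "inv x \<otimes> y"] by (simp add: word_dist_def)
  show "\<exists>n. dst x y = real n" by (auto simp: word_dist_def)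
  show "dst x z \<le> dst x y + dst y z" if z: "z \<in> carrier G"
  proof -
    have "inv x \<otimes> z = (inv x \<otimes> y) \<otimes> (inv y \<otimes> z)" using xy z by (simp add: m_assoc) (simp add: m_assoc[symmetric])
    then show ?thesis using len_mult_le[of "inv x \<otimes> y" "inv y \<otimes> z"] xy z by (simp add: word_dist_def)
  qed
  show "\<exists>z\<in>carrier G. dst x z = real t \<and> dst z y = dst x y - real t" if t: "real t \<le> dst x y"
  proof -
    have "t \<le> len (inv x \<otimes> y)" using t by (simp add: word_dist_def)
    then obtain a b where ab: "a \<in> carrier G" "b \<in> carrier G" "inv x \<otimes> y = a \<otimes> b" "len a = t"
      "len b = len (inv x \<otimes> y) - t" using len_split xy by (metis inv_closed m_closed)
    have "y = x \<otimes> a \<otimes> b" using ab(1-3) xy by (metis inv_solve_left m_assoc m_closed)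
    then have "dst (x \<otimes> a) y = len b" using dst_mult_right[of "x \<otimes> a" b] ab xy by simp
    then show ?thesis using ab xy t dst_mult_right[of x a]
      by (intro bexI[of _ "x \<otimes> a"]) (auto simp: word_dist_def)
  qed
qed

lemma gp_mult_left:
  "g \<in> carrier G \<Longrightarrow> w \<in> carrier G \<Longrightarrow> x \<in> carrier G \<Longrightarrow> y \<in> carrier G \<Longrightarrow> gp (g \<otimes> w) (g \<otimes> x) (g \<otimes> y) = gp w x y"
  by (simp add: gromov_product_def)

lemma gp_one:
  "x \<in> carrier G \<Longrightarrow> y \<in> carrier G \<Longrightarrow> gp \<one> x y = (real (len x) + real (len y) - real (len (inv x \<otimes> y))) / 2"
  by (simp add: gromov_product_def dst_one) (simp add: word_dist_def)

lemma len_le_of_letters: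
  assumes T: "T \<subseteq> carrier G" "\<And>t. t \<in> T \<Longrightarrow> len t \<le> c" and "set ws \<subseteq> T"
  shows "foldr (\<otimes>) ws \<one> \<in> carrier G \<and> len (foldr (\<otimes>) ws \<one>) \<le> c * length ws"
  using assms(3)
proof (induction ws)
  case (Cons t ws)
  then have "t \<in> carrier G" "len t \<le> c" using T by auto
  then show ?case using Cons len_mult_le[of t "foldr (\<otimes>) ws \<one>"] by auto
qed simp

lemma bilipschitz_word_dist:
  assumes T: "fin_sym_gen_set G T"
  shows "\<exists>L>0. \<forall>x\<in>carrier G. \<forall>y\<in>carrier G. dst x y \<le> L * word_dist G T x y"
proof -
  interpret T: word_group G T by unfold_locales (rule T)
  obtain c where c: "\<And>t. t \<in> T \<Longrightarrow> len t \<le> c"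
    using T.finite_S finite_imageI[of T len] by (metis Max_ge imageI)
  have "len g \<le> c * T.len g" if "g \<in> carrier G" for g
    using len_le_of_letters[OF T.S_carrier c] T.geodesic_word[OF that] by metis
  then have "dst x y \<le> real (c + 1) * word_dist G T x y" if "x \<in> carrier G" "y \<in> carrier G" for x y
  proof -
    have "len (inv x \<otimes> y) \<le> (c + 1) * T.len (inv x \<otimes> y)"
      using \<open>\<And>g. g \<in> carrier G \<Longrightarrow> len g \<le> c * T.len g\<close>[of "inv x \<otimes> y"] that by simp
    then show ?thesis unfolding word_dist_def of_nat_mult[symmetric] of_nat_le_iff .
  qed
  then show ?thesis by (intro exI[of _ "real (c + 1)"]) auto
qed

text \<open>\<open>hyperbolic_group\<close> only speaks of some generating set. Any two word metrics
  are bilipschitz, so hyperbolicity passes to the one of \<open>S\<close>.\<close>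

lemma hyperbolic_word_dist:
  assumes "hyperbolic_group G"
  obtains \<delta> where "hyperbolic_space (carrier G) dst \<delta>"
proof -
  obtain T where T: "fin_sym_gen_set G T" "gromov_hyperbolic (carrier G) (word_dist G T)"
    using assms by (auto simp: hyperbolic_group_def)
  interpret T: word_group G T by unfold_locales (rule T)
  obtain \<delta> where \<delta>: "\<forall>w\<in>carrier G. \<forall>x\<in>carrier G. \<forall>y\<in>carrier G. \<forall>z\<in>carrier G.
        T.gp w x z \<ge> min (T.gp w x y) (T.gp w y z) - \<delta>"
    using T(2) unfolding gromov_hyperbolic_def by blast
  \<comment> \<open>The definition does not ask the constant to be nonnegative, the locale
    does.\<close>
  interpret T: hyperbolic_space "carrier G" "word_dist G T" "max 0 \<delta>"
    by unfold_locales (use \<delta> in \<open>auto intro: order_trans\<close>, smt (verit))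
  obtain L1 L2 where L: "0 < L1" "0 < L2"
    "\<And>x y. x \<in> carrier G \<Longrightarrow> y \<in> carrier G \<Longrightarrow> dst x y \<le> L1 * word_dist G T x y"
    "\<And>x y. x \<in> carrier G \<Longrightarrow> y \<in> carrier G \<Longrightarrow> word_dist G T x y \<le> L2 * dst x y"
    using bilipschitz_word_dist[OF T(1)] T.bilipschitz_word_dist[OF gen] by blast
  have "gromov_hyperbolic (carrier G) dst"
  proof (rule T.bilipschitz_invariance)
    show "discrete_geodesic_space (carrier G) dst" by unfold_locales
    show "0 < max L1 L2" using L by simp
    show "word_dist G T x y \<le> max L1 L2 * dst x y" if "x \<in> carrier G" "y \<in> carrier G" for x y
      using L(4)[OF that] d_nonneg[OF that] by (meson max.cobounded2 mult_right_mono order_trans)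
    show "dst x y \<le> max L1 L2 * word_dist G T x y" if "x \<in> carrier G" "y \<in> carrier G" for x y
      using L(3)[OF that] T.d_nonneg[OF that] by (meson max.cobounded1 mult_right_mono order_trans)
  qed
  then obtain \<epsilon> where \<epsilon>: "\<forall>w\<in>carrier G. \<forall>x\<in>carrier G. \<forall>y\<in>carrier G. \<forall>z\<in>carrier G.
        gp w x z \<ge> min (gp w x y) (gp w y z) - \<epsilon>"
    unfolding gromov_hyperbolic_def by blast
  have "hyperbolic_space (carrier G) dst (max 0 \<epsilon>)"
    by unfold_locales (use \<epsilon> in \<open>auto intro: order_trans\<close>, smt (verit))
  then show thesis by (rule that)
qed

end

locale hyperbolic_word_group = word_group G S + hyperbolic_space "carrier G" "word_dist G S" \<delta>
  for G (structure) and S \<delta>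

section \<open>Quasi-axes and separated elements\<close>

text \<open>A broken geodesic with long sides and small turns does not turn back. If the product of
  \<open>p 0\<close> and \<open>p (Suc j)\<close> at \<open>p j\<close> is at most
  \<open>A + \<delta>\<close>, the side length leaves a product of at least
  \<open>A + 2 * \<delta> + 1\<close> between \<open>p 0\<close> and \<open>p j\<close> at
  \<open>p (Suc j)\<close>; as the turn there is at most \<open>A\<close>, the four-point inequality
  restores the first bound one step further. The term \<open>2 * A + 3 * \<delta> + 1\<close> also
  makes the distance from \<open>p 0\<close> grow by at least 1 per side.\<close>

lemma (in hyperbolic_space) local_to_global:
  assumes p: "\<And>i. i \<le> n \<Longrightarrow> p i \<in> M" and A: "0 \<le> A"
    and step: "\<And>i. i < n \<Longrightarrow> 2 * A + 3 * \<delta> + 1 \<le> d (p i) (p (Suc i))"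
    and turn: "\<And>i. Suc i < n \<Longrightarrow> gp (p (Suc i)) (p i) (p (Suc (Suc i))) \<le> A"
    and j: "j < n"
  shows "gp (p j) (p 0) (p (Suc j)) \<le> A + \<delta>" and "d (p 0) (p j) + 1 \<le> d (p 0) (p (Suc j))"
    and "2 * \<delta> + A + 1 \<le> gp (p (Suc j)) (p 0) (p j)"
proof -
  have len: "2 * \<delta> + A + 1 \<le> gp (p (Suc j)) (p 0) (p j)" "d (p 0) (p j) + 1 \<le> d (p 0) (p (Suc j))"
    if "j < n" "gp (p j) (p 0) (p (Suc j)) \<le> A + \<delta>" for j
    using that step[of j] d_sym[of "p j" "p (Suc j)"] d_sym[of "p 0" "p j"] d_sym[of "p 0" "p (Suc j)"] p[of j] p[of "Suc j"] p[of 0] delta_nonneg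
    by (auto simp: gromov_product_def field_simps)
  have main: "gp (p j) (p 0) (p (Suc j)) \<le> A + \<delta>" if "j < n" for j
    using that
  proof (induction j)
    case 0
    have "gp (p 0) (p 0) (p (Suc 0)) = 0"
      using p[of 0] p[of "Suc 0"] 0 d_eq_0[of "p 0" "p 0"] d_sym[of "p 0" "p (Suc 0)"]
      by (simp add: gromov_product_def)
    then show ?case using A delta_nonneg by simp
  next
    case (Suc j)
    have m: "p j \<in> M" "p (Suc j) \<in> M" "p (Suc (Suc j)) \<in> M" "p 0 \<in> M" using p Suc.prems by auto
    have "2 * \<delta> + A + 1 \<le> gp (p (Suc j)) (p 0) (p j)" using len(1)[of j] Suc by simp
    then have "2 * \<delta> + A + 1 \<le> gp (p (Suc j)) (p j) (p 0)" using gp_sym m by metis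
    then show ?case
      using hyp[OF m(2,1,4,3)] turn[of j] Suc.prems delta_nonneg by (auto simp: min_def split: if_splits)
  qed
  then show "gp (p j) (p 0) (p (Suc j)) \<le> A + \<delta>" using j by blast
  then show "2 * \<delta> + A + 1 \<le> gp (p (Suc j)) (p 0) (p j)" "d (p 0) (p j) + 1 \<le> d (p 0) (p (Suc j))"
    using len j by auto
qed

lemma (in hyperbolic_space) local_to_global_dist:
  assumes p: "\<And>i. i \<le> n \<Longrightarrow> p i \<in> M" and A: "0 \<le> A"
    and step: "\<And>i. i < n \<Longrightarrow> 2 * A + 3 * \<delta> + 1 \<le> d (p i) (p (Suc i))"
    and turn: "\<And>i. Suc i < n \<Longrightarrow> gp (p (Suc i)) (p i) (p (Suc (Suc i))) \<le> A"
  shows "real n \<le> d (p 0) (p n)"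
proof -
  have "real j \<le> d (p 0) (p j)" if "j \<le> n" for j
    using that
  proof (induction j)
    case 0
    then show ?case using d_nonneg p by auto
  next
    case (Suc j)
    then show ?case using local_to_global(2)[where n = n and p = p and A = A and j = j] assms by simp
  qed
  then show ?thesis by blast
qed

lemma (in hyperbolic_space) local_to_global_between:
  assumes p: "\<And>i. i \<le> n \<Longrightarrow> p i \<in> M" and A: "0 \<le> A"
    and step: "\<And>i. i < n \<Longrightarrow> 2 * A + 3 * \<delta> + 1 \<le> d (p i) (p (Suc i))"
    and turn: "\<And>i. Suc i < n \<Longrightarrow> gp (p (Suc i)) (p i) (p (Suc (Suc i))) \<le> A"
    and i: "i \<le> n"
  shows "gp (p i) (p 0) (p n) \<le> A + 2 * \<delta>"
proof -
  consider "i = 0" | "i = n" | j where "i = Suc j" "Suc j < n" using i by (cases i) force+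
  then show ?thesis
  proof cases
    case 1
    then show ?thesis using gp_le_dist[of "p 0" "p 0" "p n"] p[of 0] p[of n] d_eq_0[of "p 0" "p 0"] A delta_nonneg by simp
  next
    case 2
    then show ?thesis
      using gp_le_dist[of "p n" "p n" "p 0"] gp_sym[of "p 0" "p n"] p[of 0] p[of n] d_eq_0[of "p n" "p n"] A delta_nonneg
      by simp
  next
    case 3
    have m: "p j \<in> M" "p (Suc j) \<in> M" "p n \<in> M" "p 0 \<in> M" using p 3 by auto
    \<comment> \<open>The reversed chain controls the turn between \<open>p j\<close> and
      \<open>p n\<close> at \<open>p (Suc j)\<close>; the forward chain shows that
      \<open>p 0\<close> lies far out in the direction of \<open>p j\<close>.\<close>
    define q where "q i = p (n - i)" for i
    define k where "k = n - Suc j"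
    have k: "k < n" "n - k = Suc j" "n - Suc k = j" using 3 by (auto simp: k_def)
    have "gp (q k) (q 0) (q (Suc k)) \<le> A + \<delta>"
    proof (rule local_to_global(1)[where n = n])
      show "q i \<in> M" for i using p by (simp add: q_def)
      show "2 * A + 3 * \<delta> + 1 \<le> d (q i) (q (Suc i))" if "i < n" for i
        using step[of "n - Suc i"] that p[of "n - i"] p[of "n - Suc i"] d_sym[of "p (n - i)" "p (n - Suc i)"]
        by (simp add: q_def Suc_diff_Suc)
      show "gp (q (Suc i)) (q i) (q (Suc (Suc i))) \<le> A" if "Suc i < n" for i
        using turn[of "n - Suc (Suc i)"] that p[of "n - i"] p[of "n - Suc (Suc i)"]
          gp_sym[of "p (n - i)" "p (n - Suc (Suc i))"]
        by (simp add: q_def Suc_diff_Suc)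
    qed (use A k in auto)
    then have "gp (p (Suc j)) (p n) (p j) \<le> A + \<delta>" using k by (simp add: q_def)
    then have 1: "gp (p (Suc j)) (p j) (p n) \<le> A + \<delta>" using gp_sym m by metis
    have "2 * \<delta> + A + 1 \<le> gp (p (Suc j)) (p 0) (p j)"
      using local_to_global(3)[where n = n and p = p and A = A and j = j] assms(1-4) 3 by auto
    then have "2 * \<delta> + A + 1 \<le> gp (p (Suc j)) (p j) (p 0)" using gp_sym m by metis
    then show ?thesis
      using hyp[OF m(2,1,4,3)] 1 delta_nonneg 3 by (auto simp: min_def split: if_splits)
  qed
qed

section \<open>Existence of an element whose powers form a broken geodesic with small turns\<close>

context hyperbolic_word_group
begin

lemma exists_len_eq:
  assumes "infinite (carrier G)"
  obtains g where "g \<in> carrier G" "len g = n"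
proof -
  obtain g where "g \<in> carrier G" "n < len g"
    using finite_ball[of n] assms by (smt (verit) mem_Collect_eq not_le finite_subset subsetI)
  then show thesis using len_split[of g n] that by (metis less_imp_le)
qed

text \<open>Cut a long geodesic word in the middle to get \<open>x\<close>, \<open>y\<close> of equal length with Gromov product \<open>0\<close>;
  if neither \<open>x\<close> nor \<open>y\<close> works then \<open>x \<otimes> y\<close> does.\<close>

lemma exists_local_geodesic_power:
  assumes "infinite (carrier G)"
  obtains g where "g \<in> carrier G" "2 * gp \<one> (inv g) g + 3 * \<delta> + 1 \<le> len g"
proof -
  define R where "R = nat \<lceil>20 * \<delta> + 10\<rceil>"
  have R: "20 * \<delta> + 10 \<le> real R" using delta_nonneg by (simp add: R_def)
  obtain z where z: "z \<in> carrier G" "len z = 2 * R" using exists_len_eq assms by blast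
  obtain a y where ay: "a \<in> carrier G" "y \<in> carrier G" "z = a \<otimes> y" "len a = R" "len y = R"
    using len_split[of z R] z by (metis add_diff_cancel_right' le_add2 mult_2)
  define x where "x = inv a"
  have x: "x \<in> carrier G" "len x = R" "inv x = a" using ay by (auto simp: x_def)
  define g where "g = x \<otimes> y"
  have g: "g \<in> carrier G" using x ay by (simp add: g_def)
  consider "2 * gp \<one> (inv x) x + 3 * \<delta> + 1 \<le> len x" | "2 * gp \<one> (inv y) y + 3 * \<delta> + 1 \<le> len y"
    | "(R - 3 * \<delta> - 1) / 2 < gp \<one> (inv x) x" "(R - 3 * \<delta> - 1) / 2 < gp \<one> (inv y) y"
    using x ay by (simp add: field_simps) linarith
  then show thesis
  proof cases
    \<comment> \<open>Now \<open>inv x\<close> runs along \<open>x\<close> and \<open>inv y\<close>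
      along \<open>y\<close>, while \<open>x\<close> and \<open>y\<close> part at once because
      \<open>inv x \<otimes> y = z\<close> has length \<open>2 * R\<close>. So \<open>g\<close>
      starts along \<open>x\<close>, and \<open>inv g\<close> starts along \<open>inv y\<close>,
      away from \<open>x\<close>; this bounds their product by \<open>3 * \<delta>\<close>.\<close>
    case 3
    have m: "\<one> \<in> carrier G" "inv x \<in> carrier G" "inv y \<in> carrier G" "inv g \<in> carrier G" using x ay g by auto
    have xy: "gp \<one> x y = 0" using x ay z by (simp add: gp_one)
    have 1: "gp \<one> (inv x) y \<le> \<delta>"
      using hyp[OF m(1) x(1) m(2) ay(2)] gp_sym[of x "inv x" \<one>] x m xy 3(1) R by (simp add: min_def split: if_splits)
    then have lg: "2 * R - 2 * \<delta> \<le> len g" using x(1,2) ay m by (simp add: gp_one g_def)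
    have 2: "gp \<one> x (inv y) \<le> \<delta>"
      using hyp[OF m(1) x(1) m(3) ay(2)] x m xy 3(2) R by (simp add: min_def split: if_splits)
    have i: "inv x \<otimes> g = y" using x(1) ay(2) by (simp add: g_def m_assoc[symmetric])
    have i2: "inv (inv g) \<otimes> inv y = x" using x(1) ay(2) by (simp add: g_def m_assoc)
    have gx: "R - \<delta> \<le> gp \<one> x g" using lg i x(1,2) ay(2,5) g by (simp add: gp_one)
    have gy: "R - \<delta> \<le> gp \<one> (inv g) (inv y)" using lg i2 x(1,2) ay(2,5) g m by (simp add: gp_one)
    have 3: "gp \<one> x (inv g) \<le> 2 * \<delta>"
      using hyp[OF m(1) x(1) m(4,3)] gy 2 R delta_nonneg by (simp add: min_def split: if_splits)
    have "gp \<one> g (inv g) \<le> 3 * \<delta>"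
      using hyp[OF m(1) x(1) g m(4)] gx 3 R delta_nonneg by (simp add: min_def split: if_splits)
    then have "gp \<one> (inv g) g \<le> 3 * \<delta>" using gp_sym g m by metis
    then have "2 * gp \<one> (inv g) g + 3 * \<delta> + 1 \<le> len g" using lg R delta_nonneg by linarith
    then show thesis using that g by blast
  qed (use that x ay in auto)
qed

end

section \<open>The quasi-axis formed by the powers of one element\<close>

locale hyperbolic_axis = hyperbolic_word_group +
  fixes g :: 'a
  assumes g_closed [simp]: "g \<in> carrier G"
    and g_long: "2 * gp \<one> (inv g) g + 3 * \<delta> + 1 \<le> len g"
begin

text \<open>The bound of \<open>local_to_global_between\<close> for the chain of powers of
  \<open>g\<close>, whose turns are \<open>gp \<one> (inv g) g\<close>; \<open>g_long\<close> is the
  side condition of that lemma.\<close>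

definition A\<^sub>1 :: real where "A\<^sub>1 = gp \<one> (inv g) g + 2 * \<delta>"

abbreviation axis :: "int \<Rightarrow> 'a" where "axis i \<equiv> g [^]\<^bsub>G\<^esub> i"

lemma A1_nonneg: "0 \<le> A\<^sub>1"
  using gp_nonneg[of \<one> "inv g" g] delta_nonneg by (simp add: A\<^sub>1_def)

lemma axis_add: "axis (i + j) = axis i \<otimes> axis j"
  by (simp add: int_pow_mult)

lemma axis_minus: "axis (- i) = inv (axis i)"
  by (simp add: int_pow_neg)

lemma axis_succ: "axis (i + 1) = axis i \<otimes> g"
  by (simp add: int_pow_mult)

lemma axis_step: "dst (axis i) (axis (i + 1)) = len g"
  unfolding axis_succ by (simp add: dst_mult_right)

lemma axis_turn: "gp (axis i) (axis (i - 1)) (axis (i + 1)) = gp \<one> (inv g) g"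
proof -
  have "axis (i - 1) = axis i \<otimes> inv g" by (simp add: int_pow_diff)
  then have "gp (axis i) (axis (i - 1)) (axis (i + 1)) = gp (axis i \<otimes> \<one>) (axis i \<otimes> inv g) (axis i \<otimes> g)"
    by (simp add: axis_succ)
  then show ?thesis by (subst (asm) gp_mult_left) auto
qed

lemma axis_chain:
  defines "A \<equiv> gp \<one> (inv g) g" and "p \<equiv> \<lambda>a i. axis (a + int i)"
  shows "p a i \<in> carrier G" "0 \<le> A" "2 * A + 3 * \<delta> + 1 \<le> dst (p a i) (p a (Suc i))"
    "gp (p a (Suc i)) (p a i) (p a (Suc (Suc i))) \<le> A"
  using axis_step[of "a + int i"] axis_turn[of "a + int i + 1"] g_long gp_nonneg[of \<one> "inv g" g]
  by (auto simp: A_def p_def algebra_simps)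

lemma len_axis: "\<bar>real_of_int i\<bar> \<le> len (axis i)"
proof -
  have *: "real n \<le> len (axis (int n))" for n
  proof -
    have "real n \<le> dst (axis (0 + int 0)) (axis (0 + int n))"
      by (rule local_to_global_dist[where p = "\<lambda>i. axis (0 + int i)"]) (rule axis_chain)+
    then show ?thesis by (simp add: dst_one)
  qed
  show ?thesis
  proof (cases "0 \<le> i")
    case True
    then show ?thesis using *[of "nat i"] by simp
  next
    case False
    then show ?thesis using *[of "nat (- i)"] axis_minus[of i] by simp
  qed
qed

lemma len_axis_le: "len (axis i) \<le> \<bar>i\<bar> * len g"
proof -
  have *: "len (axis (int n)) \<le> n * len g" for n
  proof (induction n)
    case (Suc n)
    have "axis (int (Suc n)) = axis (int n) \<otimes> g" using axis_succ[of "int n"] by (simp add: add.commute)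
    then show ?case using Suc len_mult_le[of "axis (int n)" g] by simp
  qed simp
  have "int (len (axis (int n))) \<le> int n * int (len g)" for n
    using *[of n] by (metis of_nat_le_iff of_nat_mult)
  then show ?thesis by (cases i rule: int_cases2) (simp_all add: axis_minus)
qed

lemma axis_between:
  assumes "a \<le> b \<and> b \<le> c \<or> c \<le> b \<and> b \<le> a"
  shows "gp (axis b) (axis a) (axis c) \<le> A\<^sub>1"
proof -
  have *: "gp (axis b) (axis a) (axis c) \<le> A\<^sub>1" if "a \<le> b" "b \<le> c" for a c
  proof -
    have "gp (axis (a + int (nat (b - a)))) (axis (a + int 0)) (axis (a + int (nat (c - a)))) \<le> gp \<one> (inv g) g + 2 * \<delta>"
      by (rule local_to_global_between[where p = "\<lambda>i. axis (a + int i)"]) (rule axis_chain | use that in simp)+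
    then show ?thesis using that by (simp add: A\<^sub>1_def)
  qed
  show ?thesis
    using assms *[of a c] *[of c a] gp_sym[of "axis a" "axis c"] by auto
qed

text \<open>For a point \<open>p\<close>, \<open>dst x p\<close> is the sum of
  \<open>gp x (axis a) p\<close>, \<open>gp x p (axis b)\<close> and
  \<open>gp p (axis a) (axis b)\<close>, minus \<open>gp x (axis a) (axis b)\<close>. The three
  terms are bounded by \<open>K + \<delta> + len g\<close>, \<open>K + \<delta>\<close> and
  \<open>A\<^sub>1\<close>.\<close>

definition near_axis :: "real \<Rightarrow> real" where
  "near_axis K = 2 * (K + \<delta>) + len g + A\<^sub>1"

text \<open>A discrete intermediate value argument: follow the axis from \<open>axis a\<close> until
  the product with \<open>axis a\<close> at \<open>x\<close> first drops to
  \<open>K + \<delta>\<close>. One step earlier it still exceeds \<open>K + \<delta>\<close>, which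
  makes the product with \<open>axis b\<close> small, and it is itself bounded because one step
  changes it by at most \<open>len g\<close>.\<close>

lemma near_axis_point:
  assumes x: "x \<in> carrier G" and K: "0 \<le> K" "gp x (axis a) (axis b) \<le> K"
  obtains i where "dst x (axis i) \<le> near_axis K"
proof -
  have main: "\<exists>i. dst x (axis i) \<le> near_axis K" if ab: "a \<le> b" and gab: "gp x (axis a) (axis b) \<le> K" for a b
  proof (cases "dst (axis a) x \<le> K + \<delta>")
    case True
    then show ?thesis
      using d_sym[OF x, of "axis a"] K(1) A1_nonneg delta_nonneg by (intro exI[of _ a]) (simp add: near_axis_def)
  next
    case False
    define f where "f i = gp x (axis a) (axis (a + int i))" for i
    have f0: "K + \<delta> < f 0" using False x by (simp add: f_def gp_self)
    have fn: "f (nat (b - a)) \<le> K + \<delta>" using gab ab delta_nonneg by (simp add: f_def)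
    define i where "i = (LEAST i. f i \<le> K + \<delta>)"
    have i: "f i \<le> K + \<delta>" unfolding i_def by (rule LeastI[of "\<lambda>i. f i \<le> K + \<delta>", OF fn])
    then obtain j where j: "i = Suc j" using f0 by (cases i) auto
    then have fj: "K + \<delta> < f j" using not_less_Least[of j "\<lambda>i. f i \<le> K + \<delta>"] unfolding i_def[symmetric] by simp
    have "i \<le> nat (b - a)" unfolding i_def by (rule Least_le[of "\<lambda>i. f i \<le> K + \<delta>", OF fn])
    then have jb: "a + int j \<le> b" using j by simp
    let ?p = "axis (a + int j)"
    have "f j \<le> f i + dst ?p (axis (a + int j + 1))"
      using gp_change_arg[OF x, of "axis a" ?p "axis (a + int j + 1)"] by (simp add: f_def j algebra_simps)
    then have 1: "gp x (axis a) ?p \<le> K + \<delta> + len g" using i axis_step[of "a + int j"] by (simp add: f_def)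
    have 2: "gp x ?p (axis b) \<le> K + \<delta>"
      using hyp[OF x, of "axis a" ?p "axis b"] fj gab delta_nonneg
      by (simp add: f_def min_def split: if_splits)
    have 3: "gp ?p (axis a) (axis b) \<le> A\<^sub>1" using axis_between[of a "a + int j" b] jb by simp
    have "dst x ?p \<le> near_axis K"
      using 1 2 3 d_sym[of x ?p] d_sym[of "axis b" ?p] x d_tri[of "axis a" x "axis b"] d_sym[of x "axis b"] by (simp add: near_axis_def gromov_product_def field_simps)
    then show ?thesis by blast
  qed
  show thesis
    using main[of a b] main[of b a] K that gp_sym[of "axis a" "axis b" x] by (cases "a \<le> b") auto
qed

text \<open>Along a long common stretch every \<open>x \<otimes> axis i\<close> is within a bounded distance of the axis, so two of
  the differences coincide by the pigeonhole principle.\<close>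

lemma fellow_travel_imp_commensurating:
  assumes x: "x \<in> carrier G" and unb: "\<And>B::real. \<exists>n m. B \<le> gp \<one> (x \<otimes> axis n) (axis m)"
  obtains k k' where "k \<noteq> 0" "x \<otimes> axis k = axis k' \<otimes> x"
proof -
  define K where "K = len x + A\<^sub>1 + \<delta>"
  have K: "0 \<le> K" using A1_nonneg delta_nonneg by (simp add: K_def)
  define ball where "ball = {h \<in> carrier G. len h \<le> nat \<lfloor>near_axis K\<rfloor>}"
  have fin: "finite ball" using finite_ball by (simp add: ball_def)
  define I where "I = card ball + 1"
  \<comment> \<open>For every \<open>i < I\<close> the point
    \<open>x \<otimes> axis (s * int i)\<close> is within \<open>len x + I * len g\<close> of
    \<open>\<one>\<close>. Moving the base point there still leaves a product of at least
    \<open>K + 1\<close>.\<close>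
  obtain n m where nm: "len x + real I * len g + K + 1 \<le> gp \<one> (x \<otimes> axis n) (axis m)" using unb by blast
  define s :: int where "s = (if 0 \<le> n then 1 else - 1)"
  have "gp \<one> (x \<otimes> axis n) (axis m) \<le> len (x \<otimes> axis n)"
    using gp_le_dist[of \<one> "x \<otimes> axis n" "axis m"] x by (simp add: dst_one)
  also have "\<dots> \<le> real (len x) + real (len (axis n))" using len_mult_le[of x "axis n"] x by simp
  also have "real (len (axis n)) \<le> \<bar>n\<bar> * real (len g)"
    using len_axis_le[of n] by (metis of_int_le_iff of_int_mult of_int_of_nat_eq)
  finally have "real I * len g < \<bar>n\<bar> * real (len g)" using nm K by simp
  then have nI: "int I < \<bar>n\<bar>" by (metis mult_less_cancel_right of_int_less_iff of_int_of_nat_eq of_nat_0_le_iff not_less)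
  have near: "\<exists>j. inv (x \<otimes> axis (s * int i)) \<otimes> axis j \<in> ball" if i: "i < I" for i
  proof -
    let ?y = "x \<otimes> axis (s * int i)"
    have y: "?y \<in> carrier G" using x by simp
    have "gp ?y \<one> (x \<otimes> axis n) \<le> gp ?y x (x \<otimes> axis n) + len x"
      using gp_change_arg[of ?y "x \<otimes> axis n" \<one> x] gp_sym[of "x \<otimes> axis n" \<one> ?y] gp_sym[of "x \<otimes> axis n" x ?y] x
      by (simp add: dst_one)
    also have "gp ?y x (x \<otimes> axis n) = gp (axis (s * int i)) (axis 0) (axis n)"
    proof -
      have "gp ?y (x \<otimes> \<one>) (x \<otimes> axis n) = gp (axis (s * int i)) \<one> (axis n)"
        by (rule gp_mult_left) (use x in auto)
      then show ?thesis by (simp only: r_one[OF x] int_pow_0)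
    qed
    also have "\<dots> \<le> A\<^sub>1"
    proof (rule axis_between)
      show "0 \<le> s * int i \<and> s * int i \<le> n \<or> n \<le> s * int i \<and> s * int i \<le> 0"
        using i nI by (cases "0 \<le> n") (simp_all add: s_def)
    qed
    finally have 1: "gp ?y \<one> (x \<otimes> axis n) \<le> len x + A\<^sub>1" by simp
    have "int (len (axis (s * int i))) \<le> int i * len g"
      using len_axis_le[of "s * int i"] by (simp add: s_def split: if_splits)
    then have "len (axis (s * int i)) \<le> i * len g" by (metis of_nat_le_iff of_nat_mult)
    also have "i * len g \<le> I * len g" using i by simp
    finally have "len ?y \<le> len x + I * len g" using len_mult_le[of x "axis (s * int i)"] x by simp
    then have "real (len ?y) \<le> len x + real I * len g" by (metis of_nat_add of_nat_le_iff of_nat_mult)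
    then have "K + 1 \<le> gp ?y (x \<otimes> axis n) (axis m)"
      using gp_change_base[of \<one> ?y "x \<otimes> axis n" "axis m"] nm x by (simp add: dst_one)
    then have "gp ?y \<one> (axis m) \<le> K"
      using hyp[of ?y \<one> "axis m" "x \<otimes> axis n"] 1 gp_sym[of "x \<otimes> axis n" "axis m" ?y] x
      by (simp add: K_def min_def split: if_splits)
    then have "gp ?y (axis 0) (axis m) \<le> K" by simp
    then obtain j where "dst ?y (axis j) \<le> near_axis K" using near_axis_point[OF y K] by blast
    then have "len (inv ?y \<otimes> axis j) \<le> nat \<lfloor>near_axis K\<rfloor>" by (simp add: word_dist_def le_nat_floor)
    then show ?thesis using y by (intro exI[of _ j]) (simp add: ball_def)
  qed
  then obtain j where j: "\<And>i. i < I \<Longrightarrow> inv (x \<otimes> axis (s * int i)) \<otimes> axis (j i) \<in> ball" by metis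
  have "\<not> inj_on (\<lambda>i. inv (x \<otimes> axis (s * int i)) \<otimes> axis (j i)) {..<I}"
  proof (rule pigeonhole)
    have "card ((\<lambda>i. inv (x \<otimes> axis (s * int i)) \<otimes> axis (j i)) ` {..<I}) \<le> card ball"
      using j fin by (intro card_mono) auto
    then show "card ((\<lambda>i. inv (x \<otimes> axis (s * int i)) \<otimes> axis (j i)) ` {..<I}) < card {..<I}" by (simp add: I_def)
  qed
  then obtain i i' where ii: "i \<noteq> i'"
    and eq: "inv (x \<otimes> axis (s * int i)) \<otimes> axis (j i) = inv (x \<otimes> axis (s * int i')) \<otimes> axis (j i')"
    by (auto simp: inj_on_def)
  define a b u v where "a = axis (s * int i)" and "b = axis (s * int i')" and "u = axis (j i)" and "v = axis (j i')"
  have c: "a \<in> carrier G" "b \<in> carrier G" "u \<in> carrier G" "v \<in> carrier G" by (auto simp: a_def b_def u_def v_def)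
  have "(x \<otimes> a) \<otimes> (inv (x \<otimes> a) \<otimes> u) \<otimes> (inv v \<otimes> x) = (x \<otimes> a) \<otimes> (inv (x \<otimes> b) \<otimes> v) \<otimes> (inv v \<otimes> x)"
    using eq by (simp add: a_def b_def u_def v_def)
  moreover have "(x \<otimes> a) \<otimes> (inv (x \<otimes> a) \<otimes> u) \<otimes> (inv v \<otimes> x) = u \<otimes> inv v \<otimes> x"
    using c x by (simp add: m_assoc[symmetric])
  moreover have "(x \<otimes> a) \<otimes> (inv (x \<otimes> b) \<otimes> v) \<otimes> (inv v \<otimes> x) = x \<otimes> (a \<otimes> inv b)"
  proof -
    have "(x \<otimes> a) \<otimes> (inv (x \<otimes> b) \<otimes> v) \<otimes> (inv v \<otimes> x) = (x \<otimes> a) \<otimes> inv (x \<otimes> b) \<otimes> (v \<otimes> inv v) \<otimes> x"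
      by (simp only: m_assoc c x inv_closed m_closed)
    also have "\<dots> = x \<otimes> (a \<otimes> inv b) \<otimes> (inv x \<otimes> x)" using c x by (simp add: m_assoc inv_mult_group)
    finally show ?thesis using c x by simp
  qed
  ultimately have "x \<otimes> (a \<otimes> inv b) = u \<otimes> inv v \<otimes> x" by simp
  then have "x \<otimes> axis (s * int i - s * int i') = axis (j i - j i') \<otimes> x"
    by (simp add: int_pow_diff a_def b_def u_def v_def)
  moreover have "s * int i - s * int i' \<noteq> 0" using ii by (auto simp: s_def)
  ultimately show thesis using that by blast
qed

text \<open>The axis and its translate by \<open>x\<close> have the same ends, so \<open>x\<close> almost lies between two far points
  of the axis. The bound does not depend on \<open>x\<close>.\<close>

lemma commensurating_imp_near:
  assumes x: "x \<in> carrier G" and k: "k \<noteq> 0" "x \<otimes> axis k = axis k' \<otimes> x"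
  obtains i where "dst x (axis i) \<le> near_axis (A\<^sub>1 + 2 * \<delta>)"
proof -
  have pos: "x \<otimes> axis (k * int n) = axis (k' * int n) \<otimes> x" for n
  proof (induction n)
    case (Suc n)
    have "x \<otimes> axis (k * int (Suc n)) = (x \<otimes> axis k) \<otimes> axis (k * int n)"
      using x by (simp add: ring_distribs int_pow_mult m_assoc)
    also have "\<dots> = axis k' \<otimes> (x \<otimes> axis (k * int n))" using x k(2) by (simp add: m_assoc)
    also have "\<dots> = axis (k' * int (Suc n)) \<otimes> x" using x Suc by (simp add: ring_distribs int_pow_mult m_assoc)
    finally show ?case .
  qed (use x in simp)
  \<comment> \<open>\<open>P\<close> and \<open>P'\<close> are \<open>len x\<close> apart whatever
    \<open>n\<close> is, and so are \<open>Q\<close> and \<open>Q'\<close>. With this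
    \<open>n\<close>, the points \<open>P'\<close> and \<open>Q'\<close> are so far from
    \<open>x\<close> that the products in \<open>1\<close> and \<open>2\<close> exceed
    \<open>A\<^sub>1 + 2 * \<delta>\<close>.\<close>
  define n where "n = nat \<lceil>len x + A\<^sub>1 + 2 * \<delta>\<rceil> + 1"
  have n: "len x + A\<^sub>1 + 2 * \<delta> < real n" unfolding n_def by linarith
  define P Q P' Q' where "P = axis (k' * int n)" and "Q = axis (- (k' * int n))"
    and "P' = x \<otimes> axis (k * int n)" and "Q' = x \<otimes> axis (- (k * int n))"
  have c: "P \<in> carrier G" "Q \<in> carrier G" "P' \<in> carrier G" "Q' \<in> carrier G"
    using x by (auto simp: P_def Q_def P'_def Q'_def)
  have PP: "P' = P \<otimes> x" using pos by (simp add: P_def P'_def)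
  have QQ: "Q' = Q \<otimes> x"
  proof -
    have "P \<otimes> Q' = (P \<otimes> x) \<otimes> axis (- (k * int n))" using x by (simp add: Q'_def m_assoc P_def)
    also have "\<dots> = x \<otimes> (axis (k * int n) \<otimes> axis (- (k * int n)))" using x by (simp add: PP[symmetric] P'_def m_assoc)
    also have "\<dots> = x" using x by (simp add: int_pow_neg)
    finally have "Q' = inv P \<otimes> x" using c x by (metis inv_solve_left)
    then show ?thesis by (simp add: Q_def P_def int_pow_neg)
  qed
  have "1 \<le> \<bar>real_of_int k\<bar>" using k by linarith
  then have "real n \<le> \<bar>real_of_int (k * int n)\<bar>" by (simp add: abs_mult mult_le_cancel_right1)
  then have far: "real n \<le> len (axis (k * int n))" "real n \<le> len (axis (- (k * int n)))"
    using len_axis[of "k * int n"] len_axis[of "- (k * int n)"] by auto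
  have dP: "dst x P' = len (axis (k * int n))" "dst x Q' = len (axis (- (k * int n)))"
    using x by (auto simp: P'_def Q'_def dst_mult_right)
  have dPP: "dst P P' = len x" "dst Q Q' = len x" using c x by (auto simp: PP QQ dst_mult_right)
  have 1: "A\<^sub>1 + 2 * \<delta> < gp x P' P"
    using gp_ge_dist[OF x c(3,1)] d_sym[OF c(3,1)] d_sym[OF c(3) x] dP dPP far n by simp
  have 2: "A\<^sub>1 + 2 * \<delta> < gp x Q Q'"
    using gp_ge_dist[OF x c(4,2)] d_sym[OF c(4,2)] d_sym[OF c(4) x] gp_sym[OF c(4,2)] dP dPP far n by simp
  have "gp x P' Q' = gp \<one> (axis (k * int n)) (axis (- (k * int n)))"
    using gp_mult_left[of x \<one>] x by (simp add: P'_def Q'_def)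
  also have "\<dots> \<le> A\<^sub>1" using axis_between[of "k * int n" 0 "- (k * int n)"] linear[of "k * int n" 0] by simp
  finally have 3: "gp x P' Q' \<le> A\<^sub>1" .
  have 4: "gp x P Q' \<le> A\<^sub>1 + \<delta>"
    using hyp[OF x c(3,1,4)] 1 3 delta_nonneg by (simp add: min_def split: if_splits)
  have "gp x P Q \<le> A\<^sub>1 + 2 * \<delta>"
    using hyp[OF x c(1,2,4)] 2 4 delta_nonneg by (simp add: min_def split: if_splits)
  then show thesis
    using near_axis_point[OF x, of "A\<^sub>1 + 2 * \<delta>"] that A1_nonneg delta_nonneg unfolding P_def Q_def by auto
qed

text \<open>Every right coset of the powers of \<open>g\<close> meets the ball of radius
  \<open>D\<close>, which is finite.\<close>

lemma near_axis_imp_virtually_infinite_cyclic: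
  assumes near: "\<And>x. x \<in> carrier G \<Longrightarrow> \<exists>i. dst x (axis i) \<le> D"
  shows "virtually_infinite_cyclic G"
proof -
  define H where "H = range axis"
  have inj: "inj axis"
  proof (rule injI)
    fix i j assume "axis i = axis j"
    then have "axis (i - j) = \<one>" by (simp add: int_pow_diff)
    then show "i = j" using len_axis[of "i - j"] by simp
  qed
  have sub: "subgroup H G"
    by (rule subgroupI) (auto simp: H_def axis_minus[symmetric] axis_add[symmetric])
  have "rcosets H \<subseteq> (\<lambda>b. H #> b) ` {b \<in> carrier G. len b \<le> nat \<lfloor>D\<rfloor>}"
  proof
    fix C assume "C \<in> rcosets H"
    then obtain x where x: "x \<in> carrier G" "C = H #> x" by (auto simp: RCOSETS_def)
    obtain i where i: "dst x (axis i) \<le> D" using near x by blast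
    define b where "b = inv (axis i) \<otimes> x"
    have b: "b \<in> carrier G" using x by (simp add: b_def)
    have "real (len b) \<le> D" using i d_sym[of x "axis i"] x by (simp add: b_def word_dist_def)
    then have lb: "len b \<le> nat \<lfloor>D\<rfloor>" by (simp add: le_nat_floor)
    have "b \<in> H #> x" unfolding r_coset_def b_def H_def axis_minus[symmetric] by blast
    then have "H #> x = H #> b" by (rule repr_independence[OF _ x(1) sub])
    then show "C \<in> (\<lambda>b. H #> b) ` {b \<in> carrier G. len b \<le> nat \<lfloor>D\<rfloor>}" using x b lb by auto
  qed
  then have fin: "finite (rcosets H)" using finite_ball by (meson finite_imageI finite_subset)
  have "axis \<in> iso integer_group (G\<lparr>carrier := H\<rparr>)"
    unfolding iso_def hom_def bij_betw_def using inj by (auto simp: H_def int_pow_mult)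
  then have "integer_group \<cong> G\<lparr>carrier := H\<rparr>" by (rule is_isoI)
  then have "G\<lparr>carrier := H\<rparr> \<cong> integer_group" by (rule group.iso_sym[OF group_integer_group])
  then show ?thesis using sub fin unfolding virtually_infinite_cyclic_def by blast
qed

end

text \<open>The order of the quantifiers is the point: \<open>A\<close> is fixed before
  \<open>R\<close>, so the four elements can afterwards be taken long compared with the products
  between them.\<close>

theorem (in hyperbolic_word_group) exists_separated_family:
  assumes "non_elementary G"
  obtains A where "0 \<le> A"
    "\<And>R::nat. \<exists>f. (\<forall>i<4::nat. f i \<in> carrier G \<and> R \<le> len (f i)) \<and>
      (\<forall>i<4. \<forall>j<4. i \<noteq> j \<longrightarrow> gp \<one> (f i) (f j) \<le> A \<and> gp \<one> (inv (f i)) (inv (f j)) \<le> A)"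
proof -
  have ne: "infinite (carrier G)" "\<not> virtually_infinite_cyclic G" using assms by (auto simp: non_elementary_def)
  obtain g where g: "g \<in> carrier G" "2 * gp \<one> (inv g) g + 3 * \<delta> + 1 \<le> len g"
    using exists_local_geodesic_power ne by blast
  interpret hyperbolic_axis G S \<delta> g by unfold_locales (use g in auto)
  \<comment> \<open>The distance is the bound of \<open>commensurating_imp_near\<close>, which is
    the same for all elements and so is available before \<open>x\<close> is chosen.\<close>
  obtain x where x: "x \<in> carrier G" "\<And>i. \<not> dst x (axis i) \<le> near_axis (A\<^sub>1 + 2 * \<delta>)"
    using near_axis_imp_virtually_infinite_cyclic ne(2) by blast
  \<comment> \<open>Unbounded products would make \<open>x\<close> conjugate a nontrivial power of
    \<open>g\<close> to a power of \<open>g\<close>, and so put \<open>x\<close> near the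
    axis.\<close>
  have "\<not> (\<forall>B::real. \<exists>n m. B \<le> gp \<one> (x \<otimes> axis n) (axis m))"
    using fellow_travel_imp_commensurating[OF x(1)] commensurating_imp_near[OF x(1)] x(2) by metis
  then obtain B where B: "\<And>n m. gp \<one> (x \<otimes> axis n) (axis m) \<le> B" by (meson linear)
  \<comment> \<open>In \<open>conj\<close>, removing the right factor \<open>inv x\<close> from both
    arguments and moving the base point from \<open>\<one>\<close> to \<open>x\<close> cost
    \<open>len x\<close> each.\<close>
  define A where "A = max B A\<^sub>1 + 3 * len x"
  have A0: "0 \<le> A" using A1_nonneg by (simp add: A_def)
  have cross: "gp \<one> (x \<otimes> axis n \<otimes> inv x) (axis m) \<le> A" "gp \<one> (axis m) (x \<otimes> axis n \<otimes> inv x) \<le> A" for n m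
  proof -
    have "gp \<one> (axis m) (x \<otimes> axis n \<otimes> inv x) \<le> gp \<one> (axis m) (x \<otimes> axis n) + dst (x \<otimes> axis n \<otimes> inv x) (x \<otimes> axis n)"
      using x by (intro gp_change_arg) auto
    also have "dst (x \<otimes> axis n \<otimes> inv x) (x \<otimes> axis n) = len x"
      using x d_sym[of "x \<otimes> axis n \<otimes> inv x" "x \<otimes> axis n"] dst_mult_right[of "x \<otimes> axis n" "inv x"] by simp
    also have "gp \<one> (axis m) (x \<otimes> axis n) \<le> B" using B[of n m] gp_sym[of "axis m" "x \<otimes> axis n" \<one>] x by simp
    finally show "gp \<one> (axis m) (x \<otimes> axis n \<otimes> inv x) \<le> A" by (simp add: A_def)
    then show "gp \<one> (x \<otimes> axis n \<otimes> inv x) (axis m) \<le> A" using gp_sym x by (metis g_closed int_pow_closed inv_closed m_closed)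
  qed
  have opp: "gp \<one> (axis n) (axis (- n)) \<le> A" for n
    using axis_between[of n 0 "- n"] by (cases "0 \<le> n") (auto simp: A_def)
  have conj: "gp \<one> (x \<otimes> axis n \<otimes> inv x) (x \<otimes> axis (- n) \<otimes> inv x) \<le> A" for n
  proof -
    have d: "dst (x \<otimes> axis n \<otimes> inv x) (x \<otimes> axis n) = len x" for n
      using x d_sym[of "x \<otimes> axis n \<otimes> inv x" "x \<otimes> axis n"] dst_mult_right[of "x \<otimes> axis n" "inv x"] by simp
    let ?a = "x \<otimes> axis n" and ?b = "x \<otimes> axis (- n)"
    have "gp \<one> (?a \<otimes> inv x) (?b \<otimes> inv x) \<le> gp \<one> (?a \<otimes> inv x) ?b + len x"
      using gp_change_arg[of \<one> "?a \<otimes> inv x" "?b \<otimes> inv x" ?b] d x by simp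
    also have "gp \<one> (?a \<otimes> inv x) ?b \<le> gp \<one> ?a ?b + len x"
      using gp_change_arg[of \<one> ?b "?a \<otimes> inv x" ?a] d[of n] x gp_sym[of ?b ?a] gp_sym[of ?b "?a \<otimes> inv x"] by simp
    also have "gp \<one> ?a ?b \<le> gp x ?a ?b + len x" using gp_change_base[of \<one> x ?a ?b] x by (simp add: dst_one)
    also have "gp x ?a ?b = gp \<one> (axis n) (axis (- n))" using gp_mult_left[of x \<one> "axis n" "axis (- n)"] x by simp
    also have "\<dots> \<le> A\<^sub>1" using axis_between[of n 0 "- n"] by (cases "0 \<le> n") auto
    finally show ?thesis by (simp add: A_def)
  qed
  have "\<exists>f. (\<forall>i<4::nat. f i \<in> carrier G \<and> R \<le> len (f i)) \<and>
      (\<forall>i<4. \<forall>j<4. i \<noteq> j \<longrightarrow> gp \<one> (f i) (f j) \<le> A \<and> gp \<one> (inv (f i)) (inv (f j)) \<le> A)" for R :: nat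
  proof -
    \<comment> \<open>Conjugation by \<open>x\<close> can shorten an element by at most
      \<open>2 * len x\<close>.\<close>
    define n where "n = int (R + 2 * len x)"
    define y where "y m = x \<otimes> axis m \<otimes> inv x" for m
    define f where "f i = [axis n, axis (- n), y n, y (- n)] ! i" for i
    have y: "y m \<in> carrier G" "inv (y m) = y (- m)" for m
      using x by (auto simp: y_def inv_mult_group m_assoc int_pow_neg)
    have ax: "inv (axis n) = axis (- n)" "inv (axis (- n)) = axis n" using axis_minus[of n] by auto
    have la: "R + 2 * len x \<le> len (axis n)" "R + 2 * len x \<le> len (axis (- n))"
      using len_axis[of n] ax(1) len_inv[of "axis n"] by (auto simp: n_def)
    have ly: "R \<le> len (y m)" if "R + 2 * len x \<le> len (axis m)" for m
    proof -
      have "axis m = inv x \<otimes> y m \<otimes> x" using x by (simp add: y_def m_assoc) (simp add: m_assoc[symmetric])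
      then have "len (axis m) \<le> len x + len (y m) + len x"
        using len_mult_le[of "inv x \<otimes> y m" x] len_mult_le[of "inv x" "y m"] x y[of m] by simp
      then show ?thesis using that by simp
    qed
    have i4: "i = 0 \<or> i = 1 \<or> i = 2 \<or> i = 3" if "i < 4" for i :: nat using that by auto
    have "f i \<in> carrier G \<and> R \<le> len (f i)" if "i < 4" for i
      using i4[OF that] la ly y by (auto simp: f_def)
    moreover have "gp \<one> (f i) (f j) \<le> A \<and> gp \<one> (inv (f i)) (inv (f j)) \<le> A" if "i < 4" "j < 4" "i \<noteq> j" for i j
      using i4[OF that(1)] i4[OF that(2)] that(3) cross[of n n, folded y_def] cross[of n "- n", folded y_def]
        cross[of "- n" n, folded y_def] cross[of "- n" "- n", folded y_def]
        opp[of n] opp[of "- n"] conj[of n, folded y_def] conj[of "- n", folded y_def]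
      by (elim disjE) (simp_all add: f_def y ax)
    ultimately show ?thesis by blast
  qed
  then show thesis using that A0 by blast
qed

section \<open>Products without cancellation and growth of spheres\<close>

context hyperbolic_word_group
begin

lemma gp_one_prefix:
  "u \<in> carrier G \<Longrightarrow> v \<in> carrier G \<Longrightarrow> gp \<one> u (u \<otimes> v) = len u - gp \<one> (inv u) v"
  by (simp add: gp_one m_assoc[symmetric] field_simps)

lemma len_mult_gp:
  "u \<in> carrier G \<Longrightarrow> v \<in> carrier G \<Longrightarrow> real (len (u \<otimes> v)) = len u + len v - 2 * gp \<one> (inv u) v"
  by (simp add: gp_one field_simps)

text \<open>\<open>f\<close> is too long for the cancellations at its two ends to meet:
  \<open>f \<otimes> w\<close> still starts along \<open>f\<close>, so it cancels with
  \<open>u\<close> hardly more than \<open>f\<close> does. The losses \<open>2 * A\<close> against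
  \<open>w\<close> and \<open>2 * (A + \<delta>)\<close> against \<open>u\<close> explain the length
  \<open>4 * A + 2 * \<delta> + 1\<close>.\<close>

lemma concatenation:
  assumes c: "u \<in> carrier G" "f \<in> carrier G" "w \<in> carrier G"
    and A: "gp \<one> (inv u) f \<le> A" "gp \<one> (inv f) w \<le> A" "4 * A + 2 * \<delta> + 1 \<le> len f" "0 \<le> A"
  shows "gp \<one> (inv u) (f \<otimes> w) \<le> A + \<delta>"
    and "len u + len w < len (u \<otimes> f \<otimes> w)"
    and "len (u \<otimes> f \<otimes> w) \<le> len u + len f + len w"
proof -
  have "A + \<delta> < gp \<one> f (f \<otimes> w)" using gp_one_prefix[of f w] c A by simp
  then have "A + \<delta> < gp \<one> (f \<otimes> w) f" using gp_sym[of f "f \<otimes> w"] c by simp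
  then show 1: "gp \<one> (inv u) (f \<otimes> w) \<le> A + \<delta>"
    using hyp[of \<one> "inv u" "f \<otimes> w" f] c A(1) by (simp add: min_def split: if_splits)
  have "real (len u + len w) < real (len (u \<otimes> f \<otimes> w))"
    using len_mult_gp[of u "f \<otimes> w"] len_mult_gp[of f w] 1 c A by (simp add: m_assoc)
  then show "len u + len w < len (u \<otimes> f \<otimes> w)" by (simp only: of_nat_less_iff)
  show "len (u \<otimes> f \<otimes> w) \<le> len u + len f + len w"
    using len_mult_le[of "u \<otimes> f" w] len_mult_le[of u f] c by simp
qed

text \<open>Both \<open>a\<close> and \<open>u\<close> have almost the full product
  \<open>len u\<close> with \<open>u \<otimes> v\<close>. This recovers \<open>u\<close> from a
  product with little cancellation, up to finitely many choices.\<close>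

lemma prefix_close:
  assumes c: "u \<in> carrier G" "v \<in> carrier G" "a \<in> carrier G" "b \<in> carrier G"
    and eq: "a \<otimes> b = u \<otimes> v" and len: "len a = len u" "len b + len u = len (u \<otimes> v)"
    and K: "gp \<one> (inv u) v \<le> K" "0 \<le> K"
  shows "len (inv a \<otimes> u) \<le> 2 * (K + \<delta>)"
proof -
  have "gp \<one> a (u \<otimes> v) = len u"
    using eq len c by (simp add: eq[symmetric] gp_one_prefix) (simp add: gp_one eq len(2)[symmetric])
  moreover have "gp \<one> (u \<otimes> v) u \<ge> len u - K"
    using gp_one_prefix[OF c(1,2)] gp_sym[of u "u \<otimes> v" \<one>] K c by simp
  ultimately have "gp \<one> a u \<ge> len u - K - \<delta>"
    using hyp[of \<one> a "u \<otimes> v" u] c K by (simp add: min_def split: if_splits)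
  then show ?thesis using c len by (simp add: gp_one field_simps)
qed

text \<open>Four candidates against three conditions: each condition excludes at most one of them,
  since two excluded ones would both run along the same element and have product greater than
  \<open>A - \<delta> = B\<close>. The extra element \<open>t\<close> serves the lower count in
  \<open>card_slice_ge\<close>.\<close>

theorem exists_connecting_set:
  assumes "non_elementary G"
  obtains A F where "0 \<le> A" "finite F" "F \<subseteq> carrier G" "\<And>f. f \<in> F \<Longrightarrow> 4 * A + 2 * \<delta> + 1 \<le> len f"
    "\<And>u t w. u \<in> carrier G \<Longrightarrow> t \<in> carrier G \<Longrightarrow> w \<in> carrier G \<Longrightarrow>
      \<exists>f\<in>F. gp \<one> (inv u) f \<le> A \<and> gp \<one> t f \<le> A \<and> gp \<one> (inv f) w \<le> A"
proof -
  obtain B where B: "0 \<le> B" "\<And>R::nat. \<exists>f. (\<forall>i<4::nat. f i \<in> carrier G \<and> R \<le> len (f i)) \<and>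
      (\<forall>i<4. \<forall>j<4. i \<noteq> j \<longrightarrow> gp \<one> (f i) (f j) \<le> B \<and> gp \<one> (inv (f i)) (inv (f j)) \<le> B)"
    using exists_separated_family[OF assms] by blast
  define A where "A = B + \<delta>"
  obtain f where f: "\<forall>i<4::nat. f i \<in> carrier G \<and> nat \<lceil>4 * A + 2 * \<delta> + 1\<rceil> \<le> len (f i)"
    "\<forall>i<4. \<forall>j<4. i \<noteq> j \<longrightarrow> gp \<one> (f i) (f j) \<le> B \<and> gp \<one> (inv (f i)) (inv (f j)) \<le> B"
    using B(2)[of "nat \<lceil>4 * A + 2 * \<delta> + 1\<rceil>"] by blast
  have one: "card {i. i < 4 \<and> A < gp \<one> x (h i)} \<le> 1"
    if "x \<in> carrier G" "\<And>i::nat. i < 4 \<Longrightarrow> h i \<in> carrier G"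
      "\<And>i j. i < 4 \<Longrightarrow> j < 4 \<Longrightarrow> i \<noteq> j \<Longrightarrow> gp \<one> (h i) (h j) \<le> B" for x and h :: "nat \<Rightarrow> 'a"
  proof -
    have "i = j" if ij: "i < 4" "A < gp \<one> x (h i)" "j < 4" "A < gp \<one> x (h j)" for i j
    proof (rule ccontr)
      assume "i \<noteq> j"
      have c: "h i \<in> carrier G" "h j \<in> carrier G" using \<open>\<And>i::nat. i < 4 \<Longrightarrow> h i \<in> carrier G\<close> ij by auto
      have "A < gp \<one> (h i) x" using gp_sym[OF \<open>x \<in> carrier G\<close> c(1)] ij by simp
      then have "A - \<delta> < gp \<one> (h i) (h j)"
        using hyp[of \<one> "h i" x "h j"] c \<open>x \<in> carrier G\<close> ij by (simp add: min_def split: if_splits)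
      then show False using \<open>\<And>i j. i < 4 \<Longrightarrow> j < 4 \<Longrightarrow> i \<noteq> j \<Longrightarrow> gp \<one> (h i) (h j) \<le> B\<close>[of i j] ij \<open>i \<noteq> j\<close>
        by (simp add: A_def)
    qed
    then show ?thesis by (auto simp: card_le_Suc0_iff_eq)
  qed
  have conn: "\<exists>g\<in>f ` {..<4}. gp \<one> (inv u) g \<le> A \<and> gp \<one> t g \<le> A \<and> gp \<one> (inv g) w \<le> A"
    if utw: "u \<in> carrier G" "t \<in> carrier G" "w \<in> carrier G" for u t w
  proof -
    define P Q R where "P = {i. i < 4 \<and> A < gp \<one> (inv u) (f i)}" and "Q = {i. i < 4 \<and> A < gp \<one> t (f i)}"
      and "R = {i. i < 4 \<and> A < gp \<one> w (inv (f i))}"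
    have "card P \<le> 1" "card Q \<le> 1" "card R \<le> 1"
      unfolding P_def Q_def R_def
      using one[of "inv u" f] one[of t f] one[of w "\<lambda>i. inv (f i)"] utw f by simp_all
    then have "card (P \<union> Q \<union> R) \<le> 3"
      using card_Un_le[of "P \<union> Q" R] card_Un_le[of P Q] by simp
    moreover have "P \<union> Q \<union> R \<subseteq> {..<4}" by (auto simp: P_def Q_def R_def)
    ultimately have "P \<union> Q \<union> R \<noteq> {..<4}" by auto
    then obtain i where i: "i < 4" "i \<notin> P" "i \<notin> Q" "i \<notin> R" using \<open>P \<union> Q \<union> R \<subseteq> {..<4}\<close> by blast
    then have "gp \<one> (inv (f i)) w \<le> A" using gp_sym[of w "inv (f i)" \<one>] utw f by (auto simp: R_def)
    then show ?thesis using i by (intro bexI[of _ "f i"]) (auto simp: P_def Q_def)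
  qed
  have long: "4 * A + 2 * \<delta> + 1 \<le> len g" if "g \<in> f ` {..<4}" for g
  proof -
    have "nat \<lceil>4 * A + 2 * \<delta> + 1\<rceil> \<le> len g" using f that by auto
    then show ?thesis by linarith
  qed
  show thesis
  proof (rule that)
    show "0 \<le> A" using B(1) delta_nonneg by (simp add: A_def)
    show "finite (f ` {..<4})" by simp
    show "f ` {..<4} \<subseteq> carrier G" using f by auto
  qed (fact long conn)+
qed

end

section \<open>Counting in spheres up to constant factors\<close>

locale connecting_set = hyperbolic_word_group G S \<delta> for G (structure) and S \<delta> +
  fixes A :: real and F :: "'a set"
  assumes infinite_G: "infinite (carrier G)"
    and A_nonneg: "0 \<le> A" and finite_F: "finite F" and F_carrier: "F \<subseteq> carrier G"
    and F_long: "f \<in> F \<Longrightarrow> 4 * A + 2 * \<delta> + 1 \<le> len f"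
    and connect: "u \<in> carrier G \<Longrightarrow> t \<in> carrier G \<Longrightarrow> w \<in> carrier G \<Longrightarrow>
      \<exists>f\<in>F. gp \<one> (inv u) f \<le> A \<and> gp \<one> t f \<le> A \<and> gp \<one> (inv f) w \<le> A"
begin

definition \<rho> :: nat where "\<rho> = Max (len ` F)"

text \<open>An upper bound for the displacement that changes the length by one: at most
  \<open>\<rho>\<close> for appending a connecting element and at most \<open>\<rho>\<close> for
  cutting back in \<open>extend\<close>. Being at least 1, it also covers shortening.\<close>

definition \<kappa> :: nat where "\<kappa> = 2 * \<rho> + 1"

abbreviation sphere :: "nat \<Rightarrow> 'a set" where
  "sphere n \<equiv> {g \<in> carrier G. len g = n}"

abbreviation ball_card :: "nat \<Rightarrow> nat" where
  "ball_card r \<equiv> card {g \<in> carrier G. len g \<le> r}"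

lemma F_len_le: "f \<in> F \<Longrightarrow> len f \<le> \<rho>"
  using finite_F by (simp add: \<rho>_def)

lemma finite_sphere: "finite (sphere n)"
  by (rule finite_subset[OF _ finite_ball[of n]]) auto

lemma sphere_nonempty: "sphere n \<noteq> {}"
  using exists_len_eq[OF infinite_G] by blast

lemma card_sphere_pos: "0 < card (sphere n)"
  using finite_sphere sphere_nonempty card_gt_0_iff by blast

lemma ball_card_pos: "0 < ball_card r"
proof -
  have "{g \<in> carrier G. len g \<le> r} \<noteq> {}" using len_one one_closed by force
  then show ?thesis using finite_ball card_gt_0_iff by blast
qed

text \<open>Since \<open>u\<close> may be a dead end, append a connecting element, which certainly
  lengthens it, and cut the result back to length \<open>len u + 1\<close>.\<close>

lemma extend:
  assumes u: "u \<in> carrier G"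
  obtains v where "v \<in> carrier G" "len v = len u + 1" "len (inv u \<otimes> v) \<le> \<kappa>"
proof -
  obtain f where f: "f \<in> F" "gp \<one> (inv u) f \<le> A" "gp \<one> (inv f) \<one> \<le> A"
    using connect[OF u one_closed one_closed] by blast
  have fc: "f \<in> carrier G" using f F_carrier by auto
  have l: "len u < len (u \<otimes> f)" "len (u \<otimes> f) \<le> len u + len f"
    using concatenation(2,3)[OF u fc one_closed f(2,3) F_long[OF f(1)] A_nonneg] u fc by auto
  obtain a b where ab: "a \<in> carrier G" "b \<in> carrier G" "u \<otimes> f = a \<otimes> b" "len a = len u + 1" "len b = len (u \<otimes> f) - (len u + 1)"
    using len_split[of "u \<otimes> f" "len u + 1"] l u fc by (metis Suc_eq_plus1 Suc_leI m_closed)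
  have "inv u \<otimes> a = f \<otimes> inv b"
  proof -
    have "a = a \<otimes> b \<otimes> inv b" using ab(1,2) by (simp add: m_assoc)
    also have "\<dots> = u \<otimes> (f \<otimes> inv b)" unfolding ab(3)[symmetric] using u fc ab(2) by (simp add: m_assoc)
    finally have "a = u \<otimes> (f \<otimes> inv b)" .
    then show ?thesis using u fc ab(2) by (simp add: m_assoc[symmetric])
  qed
  then have "len (inv u \<otimes> a) \<le> len f + len b" using len_mult_le[of f "inv b"] fc ab by simp
  also have "\<dots> \<le> \<kappa>" using F_len_le[OF f(1)] l ab(5) by (simp add: \<kappa>_def)
  finally show thesis using that ab by blast
qed

lemma adjust_length:
  assumes z: "z \<in> carrier G" and "len z \<le> n + c" "n \<le> len z + c"
  obtains y where "y \<in> sphere n" "len (inv z \<otimes> y) \<le> \<kappa> * c"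
proof -
  have up: "\<exists>y\<in>carrier G. len y = len z + i \<and> len (inv z \<otimes> y) \<le> \<kappa> * i" for i
  proof (induction i)
    case 0
    then show ?case using z by (intro bexI[of _ z]) auto
  next
    case (Suc i)
    then obtain y where y: "y \<in> carrier G" "len y = len z + i" "len (inv z \<otimes> y) \<le> \<kappa> * i" by blast
    obtain v where v: "v \<in> carrier G" "len v = len y + 1" "len (inv y \<otimes> v) \<le> \<kappa>" using extend y by blast
    have "inv z \<otimes> v = (inv z \<otimes> y) \<otimes> (inv y \<otimes> v)"
      using z y v by (simp add: m_assoc) (simp add: m_assoc[symmetric])
    then have "len (inv z \<otimes> v) \<le> \<kappa> * i + \<kappa>"
      using len_mult_le[of "inv z \<otimes> y" "inv y \<otimes> v"] z y v by simp
    then show ?case using v y by (intro bexI[of _ v]) auto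
  qed
  show thesis
  proof (cases "n \<le> len z")
    case True
    then obtain a b where ab: "a \<in> carrier G" "b \<in> carrier G" "z = a \<otimes> b" "len a = n" "len b = len z - n"
      using len_split z by metis
    have "inv z \<otimes> a = inv b" using ab by (simp add: inv_mult_group m_assoc)
    then have "len (inv z \<otimes> a) \<le> c" using ab assms by simp
    also have "c \<le> \<kappa> * c" by (simp add: \<kappa>_def)
    finally show thesis using that ab by auto
  next
    case False
    then obtain y where y: "y \<in> carrier G" "len y = n" and ly: "len (inv z \<otimes> y) \<le> \<kappa> * (n - len z)"
      using up[of "n - len z"] by auto
    note ly
    also have "\<kappa> * (n - len z) \<le> \<kappa> * c" using assms by (intro mult_le_mono2) linarith
    finally show thesis using that y by auto
  qed
qed

text \<open>Lets the later counts ignore bounded errors in lengths, at the price of a constant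
  factor.\<close>

lemma card_annulus_le:
  "card {g \<in> carrier G. len g \<le> n + c \<and> n \<le> len g + c} \<le> card (sphere n) * ball_card (\<kappa> * c)"
proof -
  have "{g \<in> carrier G. len g \<le> n + c \<and> n \<le> len g + c}
    \<subseteq> (\<lambda>(y, b). y \<otimes> b) ` (sphere n \<times> {g \<in> carrier G. len g \<le> \<kappa> * c})"
  proof
    fix g assume "g \<in> {g \<in> carrier G. len g \<le> n + c \<and> n \<le> len g + c}"
    then have g: "g \<in> carrier G" "len g \<le> n + c" "n \<le> len g + c" by auto
    obtain y where y: "y \<in> sphere n" "len (inv g \<otimes> y) \<le> \<kappa> * c" using adjust_length[OF g] by blast
    have "inv (inv g \<otimes> y) = inv y \<otimes> g" using g y by (simp add: inv_mult_group)
    then have "len (inv y \<otimes> g) \<le> \<kappa> * c" using len_inv[of "inv g \<otimes> y"] y g by simp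
    moreover have "g = y \<otimes> (inv y \<otimes> g)" using g y by (simp add: m_assoc[symmetric])
    ultimately show "g \<in> (\<lambda>(y, b). y \<otimes> b) ` (sphere n \<times> {g \<in> carrier G. len g \<le> \<kappa> * c})"
      using g y by (intro image_eqI[of _ _ "(y, inv y \<otimes> g)"]) auto
  qed
  then have "card {g \<in> carrier G. len g \<le> n + c \<and> n \<le> len g + c}
    \<le> card (sphere n \<times> {g \<in> carrier G. len g \<le> \<kappa> * c})"
    by (rule surj_card_le[rotated]) (use finite_sphere finite_ball in auto)
  then show ?thesis by (simp add: card_cartesian_product)
qed

lemma card_sphere_near:
  assumes "l \<le> n + c" "n \<le> l + c"
  shows "card (sphere l) \<le> card (sphere n) * ball_card (\<kappa> * c)"
proof -
  have "card (sphere l) \<le> card {g \<in> carrier G. len g \<le> n + c \<and> n \<le> len g + c}"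
    using assms finite_ball[of "n + c"] by (intro card_mono) (auto elim: finite_subset[rotated])
  then show ?thesis using card_annulus_le order_trans by blast
qed

lemma card_sphere_submult: "card (sphere (m + n)) \<le> card (sphere m) * card (sphere n)"
proof -
  have "sphere (m + n) \<subseteq> (\<lambda>(a, b). a \<otimes> b) ` (sphere m \<times> sphere n)"
  proof
    fix g assume "g \<in> sphere (m + n)"
    then have g: "g \<in> carrier G" "len g = m + n" "m \<le> len g" by auto
    obtain a b where "a \<in> carrier G" "b \<in> carrier G" "g = a \<otimes> b" "len a = m" "len b = len g - m"
      using len_split[OF g(1,3)] by blast
    then show "g \<in> (\<lambda>(a, b). a \<otimes> b) ` (sphere m \<times> sphere n)"
      by (intro image_eqI[of _ _ "(a, b)"]) (use g in auto)
  qed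
  then have "card (sphere (m + n)) \<le> card (sphere m \<times> sphere n)"
    by (rule surj_card_le[rotated]) (use finite_sphere in auto)
  then show ?thesis by (simp add: card_cartesian_product)
qed

text \<open>A pair \<open>(u, w)\<close> is recovered, up to boundedly many choices, from an element of length \<open>m + n\<close> near
  \<open>u \<otimes> f \<otimes> w\<close>: the geodesic prefix of length \<open>m\<close> of \<open>u \<otimes> f \<otimes> w\<close> is close to \<open>u\<close>.\<close>

lemma card_sphere_supermult:
  obtains C :: nat where "0 < C" "\<And>m n. card (sphere m) * card (sphere n) \<le> C * card (sphere (m + n))"
proof -
  define D where "D = nat \<lfloor>2 * (A + \<delta> + \<delta>)\<rfloor>"
  define Ball where "Ball r = {g \<in> carrier G. len g \<le> r}" for r
  \<comment> \<open>A prefix chosen as a function of \<open>m\<close> and \<open>z\<close> only, so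
    that the decoding map \<open>h\<close> can compute it without knowing \<open>u\<close>.\<close>
  define pre where "pre m z = (SOME a. a \<in> carrier G \<and> len a = m \<and> (\<exists>b\<in>carrier G. z = a \<otimes> b \<and> len b = len z - m))" for m z
  define h where "h m = (\<lambda>(y, b, f, d). (pre m (y \<otimes> b) \<otimes> d, inv f \<otimes> inv (pre m (y \<otimes> b) \<otimes> d) \<otimes> (y \<otimes> b)))" for m
  let ?B = "Ball (\<kappa> * \<rho>) \<times> F \<times> Ball D"
  have "card (sphere m) * card (sphere n) \<le> card ?B * card (sphere (m + n))" for m n
  proof -
    have "sphere m \<times> sphere n \<subseteq> h m ` (sphere (m + n) \<times> ?B)"
    proof
      fix x assume "x \<in> sphere m \<times> sphere n"
      then obtain u w where x: "x = (u, w)" and u: "u \<in> carrier G" "len u = m" and w: "w \<in> carrier G" "len w = n"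
        by auto
      obtain f where f: "f \<in> F" "gp \<one> (inv u) f \<le> A" "gp \<one> (inv f) w \<le> A"
        using connect[OF u(1) one_closed w(1)] by blast
      have fc: "f \<in> carrier G" using f F_carrier by auto
      define z where "z = u \<otimes> f \<otimes> w"
      have z: "z \<in> carrier G" "z = u \<otimes> (f \<otimes> w)" using u w fc by (auto simp: z_def m_assoc)
      note cc = concatenation[OF u(1) fc w(1) f(2,3) F_long[OF f(1)] A_nonneg]
      have lz: "m + n < len z" "len z \<le> m + n + \<rho>"
        using cc(2,3) F_len_le[OF f(1)] u w by (auto simp: z_def)
      then obtain y where y: "y \<in> sphere (m + n)" "len (inv z \<otimes> y) \<le> \<kappa> * \<rho>"
        using adjust_length[OF z(1), of "m + n" \<rho>] by auto
      define b where "b = inv y \<otimes> z"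
      have "inv (inv z \<otimes> y) = b" using z y by (simp add: b_def inv_mult_group)
      then have b: "b \<in> Ball (\<kappa> * \<rho>)" using len_inv[of "inv z \<otimes> y"] y z by (simp add: Ball_def b_def)
      have yb: "y \<otimes> b = z" using y z by (simp add: b_def m_assoc[symmetric])
      define a where "a = pre m z"
      have "\<exists>a. a \<in> carrier G \<and> len a = m \<and> (\<exists>b\<in>carrier G. z = a \<otimes> b \<and> len b = len z - m)"
        using len_split[OF z(1), of m] lz by (metis add_leD1 less_imp_le)
      then have "a \<in> carrier G \<and> len a = m \<and> (\<exists>b\<in>carrier G. z = a \<otimes> b \<and> len b = len z - m)"
        unfolding a_def pre_def by (rule someI_ex)
      then obtain b' where a: "a \<in> carrier G" "len a = m" "b' \<in> carrier G" "a \<otimes> b' = z" "len b' = len z - m" by auto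
      define d where "d = inv a \<otimes> u"
      have "len d \<le> 2 * (A + \<delta> + \<delta>)"
        unfolding d_def by (rule prefix_close[of u "f \<otimes> w" a b'])
          (use a u w fc z lz cc(1) A_nonneg delta_nonneg in auto)
      then have d: "d \<in> Ball D" using a u by (simp add: Ball_def D_def d_def le_nat_floor)
      have ad: "a \<otimes> d = u" using a u by (simp add: d_def m_assoc[symmetric])
      have "inv f \<otimes> inv u \<otimes> z = w"
        using u w fc by (simp add: z(2) m_assoc) (simp add: m_assoc[symmetric])
      then have "x = h m (y, b, f, d)" using x yb ad by (simp add: h_def a_def)
      then show "x \<in> h m ` (sphere (m + n) \<times> ?B)" using y b f d by blast
    qed
    then have "card (sphere m \<times> sphere n) \<le> card (sphere (m + n) \<times> ?B)"
      by (rule surj_card_le[rotated]) (use finite_sphere finite_ball finite_F in \<open>auto simp: Ball_def\<close>)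
    then show ?thesis by (simp add: card_cartesian_product mult_ac)
  qed
  then show thesis using that[of "Suc (card ?B)"] by (meson le_SucI le_trans mult_le_mono1 lessI zero_less_Suc order_refl)
qed

section \<open>Sphere sizes and the upper eigenvalue inequality\<close>

definition growth :: "nat \<Rightarrow> real" where
  "growth n = real (card (sphere n))"

definition \<phi> :: "'a \<Rightarrow> real" where
  "\<phi> x = 1 / sqrt (growth (len x))"

lemma growth_pos: "0 < growth n"
  using card_sphere_pos by (simp add: growth_def)

lemma growth_submult: "growth (m + n) \<le> growth m * growth n"
  using card_sphere_submult[of m n] unfolding growth_def of_nat_mult[symmetric] of_nat_le_iff .

text \<open>The third property says that the ratio hardly depends on \<open>j\<close>; it combines
  both comparisons of sizes. The upper eigenvalue inequality uses it as stated, the lower one with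
  \<open>k\<close> and \<open>n\<close> exchanged.\<close>

lemma growth_supermult:
  obtains C where "0 < C" "\<And>m n. growth m * growth n \<le> C * growth (m + n)"
    "\<And>j k n. j \<le> k \<Longrightarrow> j \<le> n \<Longrightarrow> growth (k - j) / growth (n - j) \<le> C * (growth k / growth n)"
proof -
  obtain C :: nat where C: "0 < C" "\<And>m n. card (sphere m) * card (sphere n) \<le> C * card (sphere (m + n))"
    using card_sphere_supermult by blast
  have g: "growth m * growth n \<le> real C * growth (m + n)" for m n
    using C(2)[of m n] unfolding growth_def of_nat_mult[symmetric] of_nat_le_iff .
  have "growth (k - j) / growth (n - j) \<le> real C * (growth k / growth n)" if "j \<le> k" "j \<le> n" for j k n
  proof -
    have "growth (k - j) * growth n \<le> growth (k - j) * (growth (n - j) * growth j)"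
      using growth_submult[of "n - j" j] that growth_pos[of "k - j"] by (intro mult_left_mono) auto
    also have "\<dots> = growth (n - j) * (growth (k - j) * growth j)" by simp
    also have "\<dots> \<le> growth (n - j) * (real C * growth k)"
      using g[of "k - j" j] that growth_pos[of "n - j"] by (intro mult_left_mono) auto
    finally show ?thesis using growth_pos[of "n - j"] growth_pos[of n] by (simp add: field_simps)
  qed
  then show thesis using that[of "real C"] C g by simp
qed

lemma growth_near:
  assumes "l \<le> n + c" "n \<le> l + c"
  shows "growth l \<le> real (ball_card (\<kappa> * c)) * growth n"
  using card_sphere_near[OF assms] unfolding growth_def of_nat_mult[symmetric] of_nat_le_iff
  by (simp add: mult.commute)

lemma div_sqrt_mult: "a / sqrt (a * b) = sqrt (a / b)" if "0 < a" "0 < b" for a b :: real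
  using that by (simp add: real_sqrt_mult real_sqrt_divide real_div_sqrt divide_divide_eq_left[symmetric])

text \<open>Such a \<open>g\<close> runs along \<open>x\<close> up to its prefix \<open>a\<close> of
  length \<open>j\<close>, so \<open>inv a \<otimes> g\<close> has length \<open>k - j\<close> up to
  \<open>2 * \<delta>\<close> and determines \<open>g\<close>.\<close>

lemma card_slice_le:
  assumes x: "x \<in> carrier G" and j: "j \<le> k" "j \<le> len x"
  shows "real (card {g \<in> sphere k. nat \<lfloor>gp \<one> g x\<rfloor> = j})
    \<le> real (ball_card (\<kappa> * nat \<lceil>2 * \<delta>\<rceil>)) * growth (k - j)"
proof -
  define c where "c = nat \<lceil>2 * \<delta>\<rceil>"
  define T where "T = {g \<in> sphere k. nat \<lfloor>gp \<one> g x\<rfloor> = j}"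
  let ?N = "{g \<in> carrier G. len g \<le> (k - j) + c \<and> k - j \<le> len g + c}"
  obtain a b where ab: "a \<in> carrier G" "b \<in> carrier G" "x = a \<otimes> b" "len a = j" "len b = len x - j"
    using len_split[OF x j(2)] by blast
  have xa: "gp \<one> x a = j"
    using gp_one_prefix[OF ab(1,2)] len_mult_gp[OF ab(1,2)] gp_sym[of x a] ab j x by simp
  have "T \<subseteq> (\<lambda>v. a \<otimes> v) ` ?N"
  proof
    fix g assume "g \<in> T"
    then have g: "g \<in> carrier G" "len g = k" "nat \<lfloor>gp \<one> g x\<rfloor> = j" by (auto simp: T_def)
    then have gj: "real j \<le> gp \<one> g x" using gp_nonneg[of \<one> g x] x by auto
    have ga: "real j - \<delta> \<le> gp \<one> g a"
      using hyp[of \<one> g x a] gj xa x g ab delta_nonneg by (simp add: min_def split: if_splits)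
    have ia: "len (inv g \<otimes> a) = len (inv a \<otimes> g)"
      using len_inv[of "inv g \<otimes> a"] g ab by (simp add: inv_mult_group)
    have "real (len (inv a \<otimes> g)) \<le> real k - real j + 2 * \<delta>"
      using ga g ab ia by (simp add: gp_one field_simps)
    also have "\<dots> \<le> real (k - j + c)" using j unfolding c_def by (simp add: of_nat_diff) linarith
    finally have 1: "len (inv a \<otimes> g) \<le> k - j + c" by simp
    have "g = a \<otimes> (inv a \<otimes> g)" using g ab by (simp add: m_assoc[symmetric])
    then have "k \<le> j + len (inv a \<otimes> g)" using len_mult_le[of a "inv a \<otimes> g"] g ab by simp
    then show "g \<in> (\<lambda>v. a \<otimes> v) ` ?N"
      using 1 \<open>g = a \<otimes> (inv a \<otimes> g)\<close> g ab by (intro image_eqI[of _ _ "inv a \<otimes> g"]) auto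
  qed
  then have "card T \<le> card ?N"
    by (rule surj_card_le[rotated]) (rule finite_subset[OF _ finite_ball[of "k - j + c"]], auto)
  also have "\<dots> \<le> card (sphere (k - j)) * ball_card (\<kappa> * c)" by (rule card_annulus_le)
  finally have "card T \<le> ball_card (\<kappa> * c) * card (sphere (k - j))" by (simp add: mult.commute)
  then show ?thesis
    unfolding growth_def of_nat_mult[symmetric] of_nat_le_iff T_def c_def .
qed

theorem sphere_sum_upper:
  obtains C where "0 < C"
    "\<And>k x. x \<in> carrier G \<Longrightarrow> (\<Sum>g\<in>sphere k. \<phi> (inv g \<otimes> x)) \<le> C * (real k + 1) * sqrt (growth k) * \<phi> x"
proof -
  obtain C where C: "0 < C" "\<And>m n. growth m * growth n \<le> C * growth (m + n)"
    "\<And>j k n. j \<le> k \<Longrightarrow> j \<le> n \<Longrightarrow> growth (k - j) / growth (n - j) \<le> C * (growth k / growth n)"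
    using growth_supermult by blast
  \<comment> \<open>In a slice, \<open>len (inv g \<otimes> x)\<close> is at most
    \<open>(k - j) + (n - j)\<close> and falls short of it by less than 2, hence, being an integer,
    by at most 1.\<close>
  define q where "q = real (ball_card (\<kappa> * 1))"
  have q: "0 < q" using ball_card_pos by (simp add: q_def)
  define C3 where "C3 = real (ball_card (\<kappa> * nat \<lceil>2 * \<delta>\<rceil>))"
  have C3: "0 < C3" using ball_card_pos by (simp add: C3_def)
  define K where "K = C3 * sqrt (C * q) * sqrt C"
  have K: "0 < K" using C q C3 by (simp add: K_def)
  have "(\<Sum>g\<in>sphere k. \<phi> (inv g \<otimes> x)) \<le> K * (real k + 1) * sqrt (growth k) * \<phi> x"
    if x: "x \<in> carrier G" for k x
  proof -
    define n where "n = len x"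
    define T where "T j = {g \<in> sphere k. nat \<lfloor>gp \<one> g x\<rfloor> = j}" for j
    have slice: "(\<Sum>g\<in>T j. \<phi> (inv g \<otimes> x)) \<le> K * (sqrt (growth k) * \<phi> x)" if j: "j \<le> k" "j \<le> n" for j
    proof -
      have pt: "\<phi> (inv g \<otimes> x) \<le> sqrt (C * q) / sqrt (growth (k - j) * growth (n - j))" if "g \<in> T j" for g
      proof -
        have g: "g \<in> carrier G" "len g = k" "nat \<lfloor>gp \<one> g x\<rfloor> = j" using that by (auto simp: T_def)
        then have gj: "real j \<le> gp \<one> g x" "gp \<one> g x < real j + 1" using gp_nonneg[of \<one> g x] x by auto
        let ?l = "len (inv g \<otimes> x)"
        have "real ?l = real k + real n - 2 * gp \<one> g x" using len_mult_gp[of "inv g" x] g x by (simp add: n_def)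
        then have "real ?l \<le> real k + real n - 2 * real j" "real k + real n - 2 * real j < real ?l + 2"
          using gj by linarith+
        then have "?l \<le> (k - j + (n - j)) + 1" "k - j + (n - j) \<le> ?l + 1" using j by linarith+
        then have "growth (k - j + (n - j)) \<le> q * growth ?l"
          unfolding q_def by (intro growth_near) auto
        then have "C * growth (k - j + (n - j)) \<le> C * (q * growth ?l)" using C by (intro mult_left_mono) auto
        then have "growth (k - j) * growth (n - j) \<le> C * q * growth ?l"
          using C(2)[of "k - j" "n - j"] by simp
        then have "sqrt (growth (k - j) * growth (n - j)) \<le> sqrt (C * q) * sqrt (growth ?l)"
          by (simp add: real_sqrt_mult[symmetric])
        then show ?thesis
          using growth_pos[of ?l] growth_pos[of "k - j"] growth_pos[of "n - j"] by (simp add: \<phi>_def field_simps)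
      qed
      have "(\<Sum>g\<in>T j. \<phi> (inv g \<otimes> x)) \<le> real (card (T j)) * (sqrt (C * q) / sqrt (growth (k - j) * growth (n - j)))"
        by (rule sum_bounded_above) (rule pt)
      also have "\<dots> \<le> (C3 * growth (k - j)) * (sqrt (C * q) / sqrt (growth (k - j) * growth (n - j)))"
        using card_slice_le[OF x j(1), folded n_def, OF j(2)] C(1) q growth_pos[of "k - j"] growth_pos[of "n - j"]
        unfolding T_def C3_def by (intro mult_right_mono) auto
      also have "\<dots> = C3 * sqrt (C * q) * (growth (k - j) / sqrt (growth (k - j) * growth (n - j)))" by simp
      also have "\<dots> = C3 * sqrt (C * q) * sqrt (growth (k - j) / growth (n - j))"
        by (simp only: div_sqrt_mult growth_pos)
      also have "\<dots> \<le> C3 * sqrt (C * q) * sqrt (C * (growth k / growth n))"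
        using C(3)[OF j] C3 C(1) q by (intro mult_left_mono) auto
      also have "\<dots> = K * (sqrt (growth k) * \<phi> x)"
        by (simp add: K_def \<phi>_def n_def real_sqrt_mult real_sqrt_divide)
      finally show ?thesis .
    qed
    have nn: "0 \<le> K * (sqrt (growth k) * \<phi> x)" using K growth_pos[of k] growth_pos[of "len x"] by (simp add: \<phi>_def)
    \<comment> \<open>At most \<open>min k n + 1\<close> slices are nonempty, each with the same
      bound: this gives the factor \<open>k + 1\<close>.\<close>
    have "nat \<lfloor>gp \<one> g x\<rfloor> \<le> min k n" if "g \<in> sphere k" for g
    proof -
      have "gp \<one> g x \<le> real k" "gp \<one> x g \<le> real n" "gp \<one> g x = gp \<one> x g"
        using gp_le_dist[of \<one> g x] gp_le_dist[of \<one> x g] gp_sym[of g x \<one>] that x by (auto simp: dst_one n_def)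
      then show ?thesis by linarith
    qed
    then have "(\<Sum>g\<in>sphere k. \<phi> (inv g \<otimes> x)) = (\<Sum>j\<le>min k n. \<Sum>g\<in>T j. \<phi> (inv g \<otimes> x))"
      unfolding T_def by (intro sum.group[symmetric]) (auto simp: finite_sphere)
    also have "\<dots> \<le> real (card {..min k n}) * (K * (sqrt (growth k) * \<phi> x))"
      by (rule sum_bounded_above) (use slice in auto)
    also have "\<dots> \<le> (real k + 1) * (K * (sqrt (growth k) * \<phi> x))"
      using nn by (intro mult_right_mono) auto
    finally show ?thesis by (simp add: mult_ac)
  qed
  then show thesis using that K by blast
qed

end

section \<open>The lower eigenvalue inequality\<close>

context connecting_set
begin

text \<open>Write \<open>x = a \<otimes> t\<close> with \<open>len a = j\<close> and send
  \<open>w\<close> to \<open>z = a \<otimes> f \<otimes> w\<close>. As \<open>f\<close> also parts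
  from \<open>t\<close>, there is little cancellation in
  \<open>inv z \<otimes> x = inv w \<otimes> inv f \<otimes> t\<close>, so \<open>z\<close> leaves
  \<open>x\<close> near \<open>a\<close> and has product about \<open>j\<close> with it. A bounded
  correction moves \<open>z\<close> to length \<open>k\<close>, and \<open>w\<close> is recovered
  from the result up to boundedly many choices.\<close>

lemma card_slice_ge:
  assumes x: "x \<in> carrier G" and j: "j \<le> k" "k \<le> len x"
  shows "growth (k - j) \<le> real (ball_card (\<kappa> * \<rho>) * card F)
    * real (card {g \<in> sphere k. \<bar>gp \<one> g x - j\<bar> \<le> \<kappa> * \<rho> + \<rho>})"
proof -
  define T where "T = {g \<in> sphere k. \<bar>gp \<one> g x - j\<bar> \<le> \<kappa> * \<rho> + \<rho>}"
  define Ball where "Ball = {g \<in> carrier G. len g \<le> \<kappa> * \<rho>}"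
  obtain a t where a: "a \<in> carrier G" "t \<in> carrier G" "x = a \<otimes> t" "len a = j" "len t = len x - j"
    using len_split[OF x order_trans[OF j]] by blast
  have "sphere (k - j) \<subseteq> (\<lambda>(g, b, f). inv f \<otimes> inv a \<otimes> (g \<otimes> b)) ` (T \<times> Ball \<times> F)"
  proof
    fix w assume "w \<in> sphere (k - j)"
    then have w: "w \<in> carrier G" "len w = k - j" by auto
    obtain f where f: "f \<in> F" "gp \<one> (inv a) f \<le> A" "gp \<one> t f \<le> A" "gp \<one> (inv f) w \<le> A"
      using connect[OF a(1,2) w(1)] by blast
    have fc: "f \<in> carrier G" using f F_carrier by auto
    define z where "z = a \<otimes> f \<otimes> w"
    have z: "z \<in> carrier G" using a w fc by (simp add: z_def)
    have lz: "k < len z" "len z \<le> k + \<rho>"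
      using concatenation(2,3)[OF a(1) fc w(1) f(2,4) F_long[OF f(1)] A_nonneg] F_len_le[OF f(1)] a w j
      by (auto simp: z_def)
    have izx: "inv z \<otimes> x = inv w \<otimes> inv f \<otimes> t"
      using a(1,2) w(1) fc unfolding a(3) z_def by (simp add: inv_mult_group m_assoc) (simp add: m_assoc[symmetric])
    have "gp \<one> (inv (inv w)) (inv f) \<le> A" "gp \<one> (inv (inv f)) t \<le> A"
      using f(3,4) gp_sym[of w "inv f" \<one>] gp_sym[of f t \<one>] w fc a by auto
    moreover have "4 * A + 2 * \<delta> + 1 \<le> len (inv f)" using F_long[OF f(1)] fc by simp
    ultimately have l2: "len w + len t < len (inv z \<otimes> x)" "len (inv z \<otimes> x) \<le> len w + \<rho> + len t"
      using concatenation(2,3)[of "inv w" "inv f" t A] w fc a A_nonneg F_len_le[OF f(1)] izx by auto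
    have "2 * gp \<one> z x = real (len z) + real (len x) - real (len (inv z \<otimes> x))"
      using gp_one[OF z x] by simp
    moreover have "real (len w) = real k - real j" "real (len t) = real (len x) - real j" using w a j by auto
    ultimately have gz: "\<bar>gp \<one> z x - j\<bar> \<le> \<rho>" using lz l2 by linarith
    obtain g where g: "g \<in> sphere k" "len (inv z \<otimes> g) \<le> \<kappa> * \<rho>"
      using adjust_length[OF z, of k \<rho>] lz by auto
    have gc: "g \<in> carrier G" using g by simp
    have d: "dst z g \<le> \<kappa> * \<rho>" using g by (simp add: word_dist_def del: of_nat_mult)
    have "gp \<one> g x \<le> gp \<one> z x + \<kappa> * \<rho>" "gp \<one> z x \<le> gp \<one> g x + \<kappa> * \<rho>"
      using gp_change_arg[OF one_closed x gc z] gp_change_arg[OF one_closed x z gc] d d_sym[OF z gc]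
        gp_sym[OF x gc] gp_sym[OF x z] by auto
    then have gT: "g \<in> T" using gz g by (simp add: T_def)
    have "len (inv g \<otimes> z) \<le> \<kappa> * \<rho>"
      using g len_inv[of "inv z \<otimes> g"] z gc by (simp add: inv_mult_group)
    then have bB: "inv g \<otimes> z \<in> Ball" using z gc by (simp add: Ball_def)
    have "g \<otimes> (inv g \<otimes> z) = z" using z gc by (simp add: m_assoc[symmetric])
    moreover have "inv f \<otimes> inv a \<otimes> z = w"
      using a(1) w(1) fc by (simp add: z_def m_assoc) (simp add: m_assoc[symmetric])
    ultimately have "w = (\<lambda>(g, b, f). inv f \<otimes> inv a \<otimes> (g \<otimes> b)) (g, inv g \<otimes> z, f)" by simp
    then show "w \<in> (\<lambda>(g, b, f). inv f \<otimes> inv a \<otimes> (g \<otimes> b)) ` (T \<times> Ball \<times> F)"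
      using gT bB f(1) by blast
  qed
  moreover have "finite T" by (rule finite_subset[OF _ finite_sphere[of k]]) (auto simp: T_def)
  then have "finite (T \<times> Ball \<times> F)" using finite_ball finite_F by (simp add: Ball_def)
  ultimately have "card (sphere (k - j)) \<le> card (T \<times> Ball \<times> F)" by (rule surj_card_le[rotated])
  then have "card (sphere (k - j)) \<le> card Ball * card F * card T" by (simp add: card_cartesian_product mult_ac)
  then show ?thesis
    unfolding growth_def of_nat_mult[symmetric] of_nat_le_iff T_def Ball_def of_nat_add[symmetric] .
qed

lemma F_nonempty: "F \<noteq> {}"
  using connect[of \<one> \<one> \<one>] by auto

text \<open>The lower count only locates products within an error \<open>c\<close>, so the sets
  \<open>T j\<close> overlap. Each \<open>g\<close> lies in at most \<open>2 * c + 1\<close> of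
  them, and summing over \<open>j\<close> overcounts by at most that factor. The condition
  \<open>k \<le> len x\<close> makes all \<open>k + 1\<close> values of \<open>j\<close>
  available.\<close>

theorem sphere_sum_lower:
  obtains c where "0 < c"
    "\<And>k x. x \<in> carrier G \<Longrightarrow> k \<le> len x \<Longrightarrow> c * (real k + 1) * sqrt (growth k) * \<phi> x \<le> (\<Sum>g\<in>sphere k. \<phi> (inv g \<otimes> x))"
proof -
  obtain C where C: "0 < C" "\<And>m n. growth m * growth n \<le> C * growth (m + n)"
    "\<And>j k n. j \<le> k \<Longrightarrow> j \<le> n \<Longrightarrow> growth (k - j) / growth (n - j) \<le> C * (growth k / growth n)"
    using growth_supermult by blast
  define c where "c = \<kappa> * \<rho> + \<rho>"
  \<comment> \<open>The length of \<open>inv g \<otimes> x\<close> contains twice the product, so an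
    error \<open>c\<close> there becomes \<open>2 * c\<close>.\<close>
  define q where "q = real (ball_card (\<kappa> * (2 * c)))"
  have q: "0 < q" using ball_card_pos by (simp add: q_def)
  define B where "B = real (ball_card (\<kappa> * \<rho>) * card F)"
  have B: "0 < B" using ball_card_pos F_nonempty finite_F by (simp add: B_def card_gt_0_iff)
  define K where "K = 1 / (B * sqrt q * sqrt C * (2 * real c + 1))"
  have K: "0 < K" using C q B by (simp add: K_def)
  have "K * (real k + 1) * sqrt (growth k) * \<phi> x \<le> (\<Sum>g\<in>sphere k. \<phi> (inv g \<otimes> x))"
    if x: "x \<in> carrier G" and kx: "k \<le> len x" for k x
  proof -
    define n where "n = len x"
    define T where "T j = {g \<in> sphere k. \<bar>gp \<one> g x - real j\<bar> \<le> real c}" for j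
    define E where "E = sqrt (growth k) * \<phi> x / (B * sqrt q * sqrt C)"
    have slice: "E \<le> (\<Sum>g\<in>T j. \<phi> (inv g \<otimes> x))" if j: "j \<le> k" for j
    proof -
      have jn: "j \<le> n" using j kx by (simp add: n_def)
      have pt: "1 / (sqrt q * sqrt (growth (k - j) * growth (n - j))) \<le> \<phi> (inv g \<otimes> x)" if "g \<in> T j" for g
      proof -
        have g: "g \<in> carrier G" "len g = k" "\<bar>gp \<one> g x - real j\<bar> \<le> real c" using that by (auto simp: T_def)
        let ?l = "len (inv g \<otimes> x)"
        have "real ?l = real k + real n - 2 * gp \<one> g x" using len_mult_gp[of "inv g" x] g x by (simp add: n_def)
        then have "real ?l \<le> real k + real n - 2 * real j + 2 * real c" "real k + real n - 2 * real j \<le> real ?l + 2 * real c"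
          using g(3) by linarith+
        then have "?l \<le> (k - j + (n - j)) + 2 * c" "k - j + (n - j) \<le> ?l + 2 * c" using j jn by linarith+
        then have "growth ?l \<le> q * growth (k - j + (n - j))" unfolding q_def by (rule growth_near)
        also have "\<dots> \<le> q * (growth (k - j) * growth (n - j))"
          using growth_submult q by (intro mult_left_mono) auto
        finally have "sqrt (growth ?l) \<le> sqrt q * sqrt (growth (k - j) * growth (n - j))"
          by (simp add: real_sqrt_mult[symmetric])
        then show ?thesis
          unfolding \<phi>_def using growth_pos by (intro divide_left_mono) (auto intro!: mult_pos_pos simp: q)
      qed
      have "growth k / growth n \<le> C * (growth (k - j) / growth (n - j))"
        using C(3)[OF jn j] growth_pos[of k] growth_pos[of n] growth_pos[of "k - j"] growth_pos[of "n - j"]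
        by (simp add: field_simps)
      then have r: "sqrt (growth k) * \<phi> x \<le> sqrt C * sqrt (growth (k - j) / growth (n - j))"
        by (simp add: \<phi>_def n_def[symmetric] real_sqrt_mult[symmetric] real_sqrt_divide[symmetric])
      have "E \<le> sqrt (growth (k - j) / growth (n - j)) / (B * sqrt q)"
        using r B q C(1) by (simp add: E_def field_simps)
      also have "\<dots> = growth (k - j) / sqrt (growth (k - j) * growth (n - j)) / (B * sqrt q)"
        by (simp only: div_sqrt_mult growth_pos)
      also have "\<dots> = (growth (k - j) / B) * (1 / (sqrt q * sqrt (growth (k - j) * growth (n - j))))" by simp
      also have "\<dots> \<le> real (card (T j)) * (1 / (sqrt q * sqrt (growth (k - j) * growth (n - j))))"
      proof (rule mult_right_mono)
        have "growth (k - j) \<le> B * real (card (T j))"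
          using card_slice_ge[OF x j kx] by (simp add: B_def T_def c_def)
        then show "growth (k - j) / B \<le> real (card (T j))" using B by (simp add: field_simps)
      qed (use q growth_pos[of "k - j"] growth_pos[of "n - j"] in simp)
      also have "\<dots> \<le> (\<Sum>g\<in>T j. \<phi> (inv g \<otimes> x))" by (rule sum_bounded_below) (rule pt)
      finally show ?thesis .
    qed
    have overlap: "real (card {j. j \<le> k \<and> \<bar>gp \<one> g x - real j\<bar> \<le> real c}) \<le> 2 * real c + 1" for g
    proof -
      have "card {j. j \<le> k \<and> \<bar>gp \<one> g x - real j\<bar> \<le> real c}
        \<le> card {nat \<lceil>gp \<one> g x - real c\<rceil>..nat \<lceil>gp \<one> g x - real c\<rceil> + 2 * c}"
      proof (rule card_mono)
        show "{j. j \<le> k \<and> \<bar>gp \<one> g x - real j\<bar> \<le> real c}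
          \<subseteq> {nat \<lceil>gp \<one> g x - real c\<rceil>..nat \<lceil>gp \<one> g x - real c\<rceil> + 2 * c}"
        proof
          fix j assume "j \<in> {j. j \<le> k \<and> \<bar>gp \<one> g x - real j\<bar> \<le> real c}"
          then have "gp \<one> g x - real c \<le> real j" "real j \<le> gp \<one> g x + real c" by auto
          then show "j \<in> {nat \<lceil>gp \<one> g x - real c\<rceil>..nat \<lceil>gp \<one> g x - real c\<rceil> + 2 * c}"
            by simp linarith
        qed
      qed simp
      then show ?thesis by simp
    qed
    have nn: "0 \<le> \<phi> y" for y using growth_pos[of "len y"] by (simp add: \<phi>_def)
    have "(real k + 1) * E = (\<Sum>j\<in>{..k}. E)" by simp
    also have "\<dots> \<le> (\<Sum>j\<in>{..k}. \<Sum>g\<in>T j. \<phi> (inv g \<otimes> x))" by (rule sum_mono) (use slice in auto)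
    also have "\<dots> = (\<Sum>g\<in>sphere k. \<Sum>j\<in>{j. j \<in> {..k} \<and> \<bar>gp \<one> g x - real j\<bar> \<le> real c}. \<phi> (inv g \<otimes> x))"
      unfolding T_def by (rule sum.swap_restrict) (auto simp: finite_sphere)
    also have "\<dots> \<le> (\<Sum>g\<in>sphere k. (2 * real c + 1) * \<phi> (inv g \<otimes> x))"
      using overlap nn by (intro sum_mono) (auto intro!: mult_right_mono)
    finally have "(real k + 1) * E \<le> (2 * real c + 1) * (\<Sum>g\<in>sphere k. \<phi> (inv g \<otimes> x))"
      by (simp add: sum_distrib_left)
    then have "(real k + 1) * E / (2 * real c + 1) \<le> (\<Sum>g\<in>sphere k. \<phi> (inv g \<otimes> x))"
      by (simp add: divide_le_eq mult.commute)
    moreover have "(real k + 1) * E / (2 * real c + 1) = K * (real k + 1) * sqrt (growth k) * \<phi> x"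
      by (simp add: E_def K_def)
    ultimately show ?thesis by simp
  qed
  then show thesis using that K by blast
qed

end

section \<open>Operator norms of radial elements\<close>

lemma ell2_finite_support:
  assumes "finite B" "B \<subseteq> carrier G" "\<And>x. x \<notin> B \<Longrightarrow> f x = 0"
  shows "f \<in> ell2 G" and "ell2_norm G f = sqrt (\<Sum>x\<in>B. (cmod (f x))\<^sup>2)"
proof -
  have "(\<lambda>x. (cmod (f x))\<^sup>2) summable_on carrier G \<longleftrightarrow> (\<lambda>x. (cmod (f x))\<^sup>2) summable_on B"
    using assms by (intro summable_on_cong_neutral) auto
  then show "f \<in> ell2 G" using assms by (auto simp: ell2_def)
  have "(\<Sum>\<^sub>\<infinity>x\<in>carrier G. (cmod (f x))\<^sup>2) = (\<Sum>\<^sub>\<infinity>x\<in>B. (cmod (f x))\<^sup>2)"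
    using assms by (intro infsum_cong_neutral) auto
  then show "ell2_norm G f = sqrt (\<Sum>x\<in>B. (cmod (f x))\<^sup>2)"
    using assms(1) by (simp add: ell2_norm_def)
qed

text \<open>Cauchy-Schwarz for \<open>w * cmod f\<close> split as
  \<open>sqrt (w * \<psi>) * sqrt (w * (cmod f)\<^sup>2 / \<psi>)\<close>. Symmetry of
  \<open>W\<close> and \<open>w\<close> lets the one inequality for \<open>\<psi>\<close> serve for
  rows and columns of the kernel. Restricting to a finite \<open>Z\<close> keeps all sums finite, so
  that they can be interchanged.\<close>

lemma (in group) schur_test:
  fixes w \<psi> :: "'a \<Rightarrow> real" and f :: "'a \<Rightarrow> complex"
  assumes W: "finite W" "W \<subseteq> carrier G" "\<And>g. g \<in> W \<Longrightarrow> inv g \<in> W"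
    and w: "\<And>g. g \<in> W \<Longrightarrow> 0 \<le> w g" "\<And>g. g \<in> W \<Longrightarrow> w (inv g) = w g"
    and \<psi>: "\<And>x. x \<in> carrier G \<Longrightarrow> 0 < \<psi> x"
    and M: "\<And>x. x \<in> carrier G \<Longrightarrow> (\<Sum>g\<in>W. w g * \<psi> (inv g \<otimes> x)) \<le> M * \<psi> x" "0 \<le> M"
    and f: "f \<in> ell2 G" and Z: "finite Z" "Z \<subseteq> carrier G"
  shows "(\<Sum>x\<in>Z. (cmod (\<Sum>g\<in>W. complex_of_real (w g) * f (inv g \<otimes> x)))\<^sup>2)
    \<le> M\<^sup>2 * (\<Sum>\<^sub>\<infinity>x\<in>carrier G. (cmod (f x))\<^sup>2)"
proof -
  define Q where "Q x = (cmod (f x))\<^sup>2 / \<psi> x" for x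
  have Q0: "0 \<le> Q x" if "x \<in> carrier G" for x using \<psi>[OF that] by (simp add: Q_def)
  \<comment> \<open>All points at which \<open>f\<close> is evaluated; after the substitution
    \<open>y = inv g \<otimes> x\<close> the inner sums can be enlarged to this set, which is the
    same for all \<open>g\<close>.\<close>
  define Y where "Y = (\<Union>g\<in>W. (\<lambda>x. inv g \<otimes> x) ` Z)"
  have Y: "finite Y" "Y \<subseteq> carrier G" using W Z by (auto simp: Y_def)
  have M': "(\<Sum>g\<in>W. w g * \<psi> (g \<otimes> y)) \<le> M * \<psi> y" if y: "y \<in> carrier G" for y
  proof -
    have "bij_betw (\<lambda>g. inv g) W W"
      by (rule bij_betwI[where g = "\<lambda>g. inv g"]) (use W in auto)
    then have "(\<Sum>g\<in>W. w g * \<psi> (g \<otimes> y)) = (\<Sum>g\<in>W. w (inv g) * \<psi> (inv g \<otimes> y))"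
      by (rule sum.reindex_bij_betw[symmetric])
    also have "\<dots> = (\<Sum>g\<in>W. w g * \<psi> (inv g \<otimes> y))" using w by (intro sum.cong) auto
    finally show ?thesis using M y by simp
  qed
  have pt: "(cmod (\<Sum>g\<in>W. complex_of_real (w g) * f (inv g \<otimes> x)))\<^sup>2 \<le> M * \<psi> x * (\<Sum>g\<in>W. w g * Q (inv g \<otimes> x))"
    if x: "x \<in> carrier G" for x
  proof -
    have nn: "0 \<le> w g * \<psi> (inv g \<otimes> x)" "0 \<le> w g * Q (inv g \<otimes> x)" if "g \<in> W" for g
    proof -
      have c: "inv g \<otimes> x \<in> carrier G" using that W(2) x by auto
      show "0 \<le> w g * \<psi> (inv g \<otimes> x)" "0 \<le> w g * Q (inv g \<otimes> x)"
        using w(1)[OF that] \<psi>[OF c] Q0[OF c] by simp_all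
    qed
    have "cmod (\<Sum>g\<in>W. complex_of_real (w g) * f (inv g \<otimes> x)) \<le> (\<Sum>g\<in>W. w g * cmod (f (inv g \<otimes> x)))"
      by (rule order_trans[OF norm_sum]) (use w in \<open>auto simp: norm_mult intro!: sum_mono\<close>)
    also have "\<dots> = (\<Sum>g\<in>W. sqrt (w g * \<psi> (inv g \<otimes> x)) * sqrt (w g * Q (inv g \<otimes> x)))"
    proof (rule sum.cong[OF refl])
      fix g assume g: "g \<in> W"
      then have "0 < \<psi> (inv g \<otimes> x)" using W x \<psi> by auto
      then have "w g * \<psi> (inv g \<otimes> x) * (w g * Q (inv g \<otimes> x)) = (w g * cmod (f (inv g \<otimes> x)))\<^sup>2"
        by (simp add: Q_def power2_eq_square)
      then show "w g * cmod (f (inv g \<otimes> x)) = sqrt (w g * \<psi> (inv g \<otimes> x)) * sqrt (w g * Q (inv g \<otimes> x))"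
        using w(1)[OF g] by (simp add: real_sqrt_mult[symmetric])
    qed
    finally have "(cmod (\<Sum>g\<in>W. complex_of_real (w g) * f (inv g \<otimes> x)))\<^sup>2
      \<le> (\<Sum>g\<in>W. sqrt (w g * \<psi> (inv g \<otimes> x)) * sqrt (w g * Q (inv g \<otimes> x)))\<^sup>2"
      by (rule power_mono) simp
    also have "\<dots> \<le> (\<Sum>g\<in>W. (sqrt (w g * \<psi> (inv g \<otimes> x)))\<^sup>2) * (\<Sum>g\<in>W. (sqrt (w g * Q (inv g \<otimes> x)))\<^sup>2)"
      by (rule Cauchy_Schwarz_ineq_sum)
    also have "(\<Sum>g\<in>W. (sqrt (w g * \<psi> (inv g \<otimes> x)))\<^sup>2) = (\<Sum>g\<in>W. w g * \<psi> (inv g \<otimes> x))"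
      by (intro sum.cong refl real_sqrt_pow2 nn)
    also have "(\<Sum>g\<in>W. (sqrt (w g * Q (inv g \<otimes> x)))\<^sup>2) = (\<Sum>g\<in>W. w g * Q (inv g \<otimes> x))"
      by (intro sum.cong refl real_sqrt_pow2 nn)
    also have "(\<Sum>g\<in>W. w g * \<psi> (inv g \<otimes> x)) * (\<Sum>g\<in>W. w g * Q (inv g \<otimes> x)) \<le> M * \<psi> x * (\<Sum>g\<in>W. w g * Q (inv g \<otimes> x))"
      by (intro mult_right_mono M(1)[OF x] sum_nonneg nn)
    finally show ?thesis .
  qed
  have "(\<Sum>x\<in>Z. (cmod (\<Sum>g\<in>W. complex_of_real (w g) * f (inv g \<otimes> x)))\<^sup>2)
    \<le> (\<Sum>x\<in>Z. M * \<psi> x * (\<Sum>g\<in>W. w g * Q (inv g \<otimes> x)))"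
    using pt Z by (intro sum_mono) auto
  also have "\<dots> = M * (\<Sum>x\<in>Z. \<Sum>g\<in>W. w g * (\<psi> x * Q (inv g \<otimes> x)))"
    by (simp add: sum_distrib_left mult_ac)
  also have "\<dots> = M * (\<Sum>g\<in>W. w g * (\<Sum>x\<in>Z. \<psi> x * Q (inv g \<otimes> x)))"
    by (subst sum.swap) (simp add: sum_distrib_left)
  also have "\<dots> \<le> M * (\<Sum>g\<in>W. w g * (\<Sum>y\<in>Y. \<psi> (g \<otimes> y) * Q y))"
  proof (intro mult_left_mono[OF _ M(2)] sum_mono mult_left_mono)
    fix g assume g: "g \<in> W"
    then have gc: "g \<in> carrier G" using W by auto
    have inj: "inj_on (\<lambda>x. inv g \<otimes> x) Z"
      using Z gc by (intro inj_onI) (metis inv_closed l_cancel subsetD)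
    have "(\<Sum>x\<in>Z. \<psi> x * Q (inv g \<otimes> x)) = (\<Sum>x\<in>Z. \<psi> (g \<otimes> (inv g \<otimes> x)) * Q (inv g \<otimes> x))"
      using Z gc by (intro sum.cong) (auto simp: m_assoc[symmetric] subset_iff)
    also have "\<dots> = (\<Sum>y\<in>(\<lambda>x. inv g \<otimes> x) ` Z. \<psi> (g \<otimes> y) * Q y)"
      by (simp add: sum.reindex[OF inj])
    also have "\<dots> \<le> (\<Sum>y\<in>Y. \<psi> (g \<otimes> y) * Q y)"
    proof (rule sum_mono2[OF Y(1)])
      show "(\<lambda>x. inv g \<otimes> x) ` Z \<subseteq> Y" using g by (auto simp: Y_def)
      fix y assume "y \<in> Y - (\<lambda>x. inv g \<otimes> x) ` Z"
      then have "y \<in> carrier G" using Y by auto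
      then show "0 \<le> \<psi> (g \<otimes> y) * Q y" using Q0 \<psi>[of "g \<otimes> y"] gc by simp
    qed
    finally show "(\<Sum>x\<in>Z. \<psi> x * Q (inv g \<otimes> x)) \<le> (\<Sum>y\<in>Y. \<psi> (g \<otimes> y) * Q y)" .
  qed (rule w)
  also have "(\<Sum>g\<in>W. w g * (\<Sum>y\<in>Y. \<psi> (g \<otimes> y) * Q y)) = (\<Sum>y\<in>Y. Q y * (\<Sum>g\<in>W. w g * \<psi> (g \<otimes> y)))"
    by (simp add: sum_distrib_left) (subst sum.swap, simp add: mult_ac)
  also have "M * (\<Sum>y\<in>Y. Q y * (\<Sum>g\<in>W. w g * \<psi> (g \<otimes> y))) \<le> M * (\<Sum>y\<in>Y. M * (cmod (f y))\<^sup>2)"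
  proof (intro mult_left_mono[OF _ M(2)] sum_mono)
    fix y assume "y \<in> Y"
    then have y: "y \<in> carrier G" using Y by auto
    have "Q y * (\<Sum>g\<in>W. w g * \<psi> (g \<otimes> y)) \<le> Q y * (M * \<psi> y)" by (rule mult_left_mono[OF M'[OF y] Q0[OF y]])
    also have "\<dots> = M * (cmod (f y))\<^sup>2" using \<psi>[OF y] by (simp add: Q_def)
    finally show "Q y * (\<Sum>g\<in>W. w g * \<psi> (g \<otimes> y)) \<le> M * (cmod (f y))\<^sup>2" .
  qed
  also have "M * (\<Sum>y\<in>Y. M * (cmod (f y))\<^sup>2) = M\<^sup>2 * (\<Sum>y\<in>Y. (cmod (f y))\<^sup>2)"
    by (simp add: sum_distrib_left[symmetric] power2_eq_square)
  also have "\<dots> \<le> M\<^sup>2 * (\<Sum>\<^sub>\<infinity>x\<in>carrier G. (cmod (f x))\<^sup>2)"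
    using f Y by (intro mult_left_mono finite_sum_le_infsum) (auto simp: ell2_def)
  finally show ?thesis .
qed

section \<open>Radial elements: both norm bounds\<close>

context connecting_set
begin

lemma ell2_norm_sphere:
  assumes "0 \<le> r"
  shows "ell2_norm G (\<lambda>x. complex_of_real r * sphere_sum G S k x) = r * sqrt (growth k)"
proof -
  have "ell2_norm G (\<lambda>x. complex_of_real r * sphere_sum G S k x)
    = sqrt (\<Sum>x\<in>sphere k. (cmod (complex_of_real r * sphere_sum G S k x))\<^sup>2)"
    by (rule ell2_finite_support(2)) (auto simp: finite_sphere sphere_sum_def)
  also have "(\<Sum>x\<in>sphere k. (cmod (complex_of_real r * sphere_sum G S k x))\<^sup>2) = r\<^sup>2 * growth k"
    by (simp add: sphere_sum_def growth_def)
  finally show ?thesis using assms by (simp add: real_sqrt_mult)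
qed

definition radial :: "nat set \<Rightarrow> (nat \<Rightarrow> real) \<Rightarrow> 'a \<Rightarrow> complex" where
  "radial K a = (\<lambda>x. \<Sum>k\<in>K. complex_of_real (a k) * sphere_sum G S k x)"

lemma radial_eq:
  assumes "finite K"
  shows "radial K a x = (if x \<in> carrier G \<and> len x \<in> K then complex_of_real (a (len x)) else 0)"
proof -
  have "radial K a x = (\<Sum>k\<in>K. if k = len x then (if x \<in> carrier G then complex_of_real (a k) else 0) else 0)"
    unfolding radial_def by (intro sum.cong) (auto simp: sphere_sum_def)
  then show ?thesis using assms by simp
qed

lemma finite_shells: "finite K \<Longrightarrow> finite {g \<in> carrier G. len g \<in> K}"
proof -
  assume "finite K"
  moreover have "{g \<in> carrier G. len g \<in> K} = (\<Union>k\<in>K. sphere k)" by auto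
  ultimately show ?thesis using finite_sphere by simp
qed

lemma sum_shells:
  fixes a :: "nat \<Rightarrow> real" and h :: "'a \<Rightarrow> real"
  assumes "finite K"
  shows "(\<Sum>g\<in>{g \<in> carrier G. len g \<in> K}. a (len g) * h g) = (\<Sum>k\<in>K. a k * (\<Sum>g\<in>sphere k. h g))"
proof -
  have "(\<Sum>g\<in>{g \<in> carrier G. len g \<in> K}. a (len g) * h g)
    = (\<Sum>k\<in>K. \<Sum>g\<in>{g \<in> {g \<in> carrier G. len g \<in> K}. len g = k}. a (len g) * h g)"
    by (rule sum.group[symmetric]) (use assms finite_shells in auto)
  also have "\<dots> = (\<Sum>k\<in>K. \<Sum>g\<in>sphere k. a k * h g)" by (intro sum.cong) auto
  finally show ?thesis by (simp add: sum_distrib_left)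
qed

lemma radial_in_group_algebra:
  assumes "finite K" shows "radial K a \<in> group_algebra G"
proof -
  have sub: "{x. radial K a x \<noteq> 0} \<subseteq> {g \<in> carrier G. len g \<in> K}"
    using assms by (auto simp: radial_eq split: if_splits)
  then show ?thesis using finite_subset[OF sub finite_shells[OF assms]] by (auto simp: group_algebra_def)
qed

lemma left_regular_radial:
  assumes "finite K" "x \<in> carrier G"
  shows "left_regular G (radial K a) f x
    = (\<Sum>g\<in>{g \<in> carrier G. len g \<in> K}. complex_of_real (a (len g)) * f (inv g \<otimes> x))"
proof -
  have "left_regular G (radial K a) f x
    = (\<Sum>g\<in>{g \<in> carrier G. len g \<in> K}. radial K a g * left_translate G g f x)"
    unfolding left_regular_def
    by (rule sum.mono_neutral_left) (use assms finite_shells in \<open>auto simp: radial_eq split: if_splits\<close>)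
  then show ?thesis using assms by (simp add: radial_eq left_translate_def)
qed

lemma \<phi>_pos: "0 < \<phi> x"
  using growth_pos by (simp add: \<phi>_def)

text \<open>The normalization that makes the mass of \<open>\<phi>\<close> on a union of spheres the
  number of radii, so passing to a shell keeps a known proportion of it.\<close>

lemma sum_\<phi>_sphere: "(\<Sum>x\<in>sphere n. (\<phi> x)\<^sup>2) = 1"
proof -
  have "(\<Sum>x\<in>sphere n. (\<phi> x)\<^sup>2) = (\<Sum>x\<in>sphere n. 1 / growth n)"
    by (intro sum.cong) (auto simp: \<phi>_def power_divide growth_pos less_imp_le)
  then show ?thesis using growth_pos[of n] by (simp add: growth_def)
qed

lemma sum_\<phi>_shells: "finite K \<Longrightarrow> (\<Sum>x\<in>{g \<in> carrier G. len g \<in> K}. (\<phi> x)\<^sup>2) = card K"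
  using sum_shells[of K "\<lambda>_. 1" "\<lambda>x. (\<phi> x)\<^sup>2"] by (simp add: sum_\<phi>_sphere)

lemma op_norm_upper:
  assumes K: "finite K" and a: "\<And>k. k \<in> K \<Longrightarrow> 0 \<le> a k" and M: "0 \<le> M"
    and bound: "\<And>x. x \<in> carrier G \<Longrightarrow> (\<Sum>k\<in>K. a k * (\<Sum>g\<in>sphere k. \<phi> (inv g \<otimes> x))) \<le> M * \<phi> x"
  shows "ell2_op_norm G (left_regular G (radial K a)) \<le> M"
  unfolding ell2_op_norm_def
proof (rule cSUP_least)
  have bound': "(\<Sum>g\<in>{g \<in> carrier G. len g \<in> K}. a (len g) * \<phi> (inv g \<otimes> x)) \<le> M * \<phi> x"
    if "x \<in> carrier G" for x
    using bound[OF that] sum_shells[OF K, of a "\<lambda>g. \<phi> (inv g \<otimes> x)"] by simp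
  have "(\<lambda>_. 0) \<in> ell2 G" "ell2_norm G (\<lambda>_. 0) = 0"
    using ell2_finite_support[of "{}" G "\<lambda>_. 0"] by auto
  then show "{f \<in> ell2 G. ell2_norm G f \<le> 1} \<noteq> {}" by force
  fix f assume "f \<in> {f \<in> ell2 G. ell2_norm G f \<le> 1}"
  then have f: "f \<in> ell2 G" "ell2_norm G f \<le> 1" by auto
  have f1: "(\<Sum>\<^sub>\<infinity>x\<in>carrier G. (cmod (f x))\<^sup>2) \<le> 1" using f(2) by (simp add: ell2_norm_def)
  have "(\<Sum>\<^sub>\<infinity>x\<in>carrier G. (cmod (left_regular G (radial K a) f x))\<^sup>2) \<le> M\<^sup>2 * (\<Sum>\<^sub>\<infinity>x\<in>carrier G. (cmod (f x))\<^sup>2)"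
  proof (rule infsum_le_finite_sums)
    show "(\<lambda>x. (cmod (left_regular G (radial K a) f x))\<^sup>2) summable_on carrier G"
      using left_regular_bound(1)[OF radial_in_group_algebra[OF K] f(1)] by (simp add: ell2_def)
    fix Z assume Z: "finite Z" "Z \<subseteq> carrier G"
    have "(\<Sum>x\<in>Z. (cmod (left_regular G (radial K a) f x))\<^sup>2)
      = (\<Sum>x\<in>Z. (cmod (\<Sum>g\<in>{g \<in> carrier G. len g \<in> K}. complex_of_real (a (len g)) * f (inv g \<otimes> x)))\<^sup>2)"
      using Z by (intro sum.cong) (auto simp: left_regular_radial[OF K] subset_iff)
    also have "\<dots> \<le> M\<^sup>2 * (\<Sum>\<^sub>\<infinity>x\<in>carrier G. (cmod (f x))\<^sup>2)"
      by (rule schur_test[where \<psi> = \<phi>])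
        (use K a M bound' f Z finite_shells \<phi>_pos in auto)
    finally show "(\<Sum>x\<in>Z. (cmod (left_regular G (radial K a) f x))\<^sup>2) \<le> M\<^sup>2 * (\<Sum>\<^sub>\<infinity>x\<in>carrier G. (cmod (f x))\<^sup>2)" .
  qed
  also have "\<dots> \<le> M\<^sup>2" using mult_left_mono[OF f1, of "M\<^sup>2"] by simp
  finally show "ell2_norm G (left_regular G (radial K a) f) \<le> M"
    unfolding ell2_norm_def using M real_sqrt_le_mono by fastforce
qed

text \<open>Test on \<open>\<phi>\<close> restricted to the ball of radius \<open>4 * r\<close> and
  look only at the shell \<open>r \<le> len x \<le> 3 * r\<close>: its inner radius makes
  \<open>bound\<close> applicable, its outer radius keeps every \<open>inv g \<otimes> x\<close>
  inside the ball. The shell has \<open>2 * r + 1\<close> of the \<open>4 * r + 1\<close> radii,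
  more than a quarter, which gives the factor 1/2 for the norm.\<close>

lemma op_norm_lower:
  assumes K: "finite K" and a: "\<And>k. k \<in> K \<Longrightarrow> 0 \<le> a k" and M: "0 \<le> M" and r: "\<And>k. k \<in> K \<Longrightarrow> k \<le> r"
    and bound: "\<And>x. x \<in> carrier G \<Longrightarrow> r \<le> len x \<Longrightarrow> M * \<phi> x \<le> (\<Sum>k\<in>K. a k * (\<Sum>g\<in>sphere k. \<phi> (inv g \<otimes> x)))"
  shows "M / 2 \<le> ell2_op_norm G (left_regular G (radial K a))"
proof -
  let ?W = "{g \<in> carrier G. len g \<in> K}"
  define R where "R = real (4 * r + 1)"
  have R: "0 < R" by (simp add: R_def)
  define B where "B = {g \<in> carrier G. len g \<in> {..4 * r}}"
  define f where "f x = (if x \<in> B then complex_of_real (\<phi> x / sqrt R) else 0)" for x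
  have B: "finite B" "B \<subseteq> carrier G" unfolding B_def using finite_shells[of "{..4 * r}"] by auto
  have fell: "f \<in> ell2 G" by (rule ell2_finite_support(1)[OF B]) (simp add: f_def)
  have "ell2_norm G f = sqrt (\<Sum>x\<in>B. (cmod (f x))\<^sup>2)"
    by (rule ell2_finite_support(2)[OF B]) (simp add: f_def)
  also have "(\<Sum>x\<in>B. (cmod (f x))\<^sup>2) = (\<Sum>x\<in>B. (\<phi> x)\<^sup>2) / R"
    using R by (simp add: f_def norm_divide power_divide sum_divide_distrib)
  also have "(\<Sum>x\<in>B. (\<phi> x)\<^sup>2) = R" unfolding B_def using sum_\<phi>_shells[of "{..4 * r}"] by (simp add: R_def)
  finally have f1: "ell2_norm G f = 1" using R by simp
  define Z where "Z = {g \<in> carrier G. len g \<in> {r..3 * r}}"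
  have Z: "finite Z" "Z \<subseteq> carrier G" unfolding Z_def using finite_shells[of "{r..3 * r}"] by auto
  have pt: "(M * \<phi> x / sqrt R)\<^sup>2 \<le> (cmod (left_regular G (radial K a) f x))\<^sup>2" if "x \<in> Z" for x
  proof -
    have x: "x \<in> carrier G" "r \<le> len x" "len x \<le> 3 * r" using that by (auto simp: Z_def)
    have "f (inv g \<otimes> x) = complex_of_real (\<phi> (inv g \<otimes> x) / sqrt R)" if "g \<in> ?W" for g
    proof -
      have "len (inv g \<otimes> x) \<le> len g + len x" using len_mult_le[of "inv g" x] that x by simp
      then have "inv g \<otimes> x \<in> B" using that x r[of "len g"] by (auto simp: B_def)
      then show ?thesis by (simp add: f_def)
    qed
    then have "left_regular G (radial K a) f x
      = (\<Sum>g\<in>?W. complex_of_real (a (len g)) * complex_of_real (\<phi> (inv g \<otimes> x) / sqrt R))"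
      unfolding left_regular_radial[OF K x(1)] by (intro sum.cong) auto
    also have "\<dots> = complex_of_real ((\<Sum>g\<in>?W. a (len g) * \<phi> (inv g \<otimes> x)) / sqrt R)"
      by (simp add: sum_divide_distrib)
    also have "(\<Sum>g\<in>?W. a (len g) * \<phi> (inv g \<otimes> x)) = (\<Sum>k\<in>K. a k * (\<Sum>g\<in>sphere k. \<phi> (inv g \<otimes> x)))"
      by (rule sum_shells[OF K])
    finally have eq: "left_regular G (radial K a) f x
      = complex_of_real ((\<Sum>k\<in>K. a k * (\<Sum>g\<in>sphere k. \<phi> (inv g \<otimes> x))) / sqrt R)" .
    have "M * \<phi> x / sqrt R \<le> (\<Sum>k\<in>K. a k * (\<Sum>g\<in>sphere k. \<phi> (inv g \<otimes> x))) / sqrt R"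
      using bound[OF x(1,2)] R by (intro divide_right_mono) auto
    also have "\<dots> \<le> cmod (left_regular G (radial K a) f x)"
      unfolding eq norm_of_real by (rule abs_ge_self)
    finally show ?thesis using M R \<phi>_pos[of x] by (intro power_mono) auto
  qed
  have "(M / 2)\<^sup>2 \<le> M\<^sup>2 * (real (2 * r + 1) / R)"
    using R by (simp add: R_def power_divide field_simps)
  also have "\<dots> = (\<Sum>x\<in>Z. (M * \<phi> x / sqrt R)\<^sup>2)"
  proof -
    have "(\<Sum>x\<in>Z. (M * \<phi> x / sqrt R)\<^sup>2) = M\<^sup>2 * ((\<Sum>x\<in>Z. (\<phi> x)\<^sup>2) / R)"
      using R by (simp add: power_divide power_mult_distrib sum_divide_distrib sum_distrib_left)
    also have "(\<Sum>x\<in>Z. (\<phi> x)\<^sup>2) = real (card {r..3 * r})" unfolding Z_def by (rule sum_\<phi>_shells) simp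
    finally show ?thesis by simp
  qed
  also have "\<dots> \<le> (\<Sum>x\<in>Z. (cmod (left_regular G (radial K a) f x))\<^sup>2)" by (rule sum_mono) (rule pt)
  also have "\<dots> \<le> (\<Sum>\<^sub>\<infinity>x\<in>carrier G. (cmod (left_regular G (radial K a) f x))\<^sup>2)"
    using left_regular_bound(1)[OF radial_in_group_algebra[OF K] fell] Z
    by (intro finite_sum_le_infsum) (auto simp: ell2_def)
  finally have "M / 2 \<le> ell2_norm G (left_regular G (radial K a) f)"
    unfolding ell2_norm_def by (rule real_le_rsqrt)
  also have "\<dots> \<le> ell2_op_norm G (left_regular G (radial K a))"
    unfolding ell2_op_norm_def
    by (rule cSUP_upper[OF _ bdd_above_left_regular[OF radial_in_group_algebra[OF K]]]) (use fell f1 in simp)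
  finally show ?thesis .
qed

text \<open>All eigenvalue inequalities concern the same \<open>\<phi>\<close>, so for nonnegative
  \<open>a k\<close> they can be summed over \<open>K\<close> before an operator norm is estimated.
  The lower ones hold simultaneously from an upper bound \<open>r\<close> of \<open>K\<close>
  on.\<close>

theorem radial_norm_equivalence:
  obtains c C where "0 < c" "0 < C"
    "\<And>K a. finite K \<Longrightarrow> (\<forall>k\<in>K. 0 \<le> a k) \<Longrightarrow>
      c * (\<Sum>k\<in>K. (real k + 1) * (a k * sqrt (growth k))) \<le> ell2_op_norm G (left_regular G (radial K a)) \<and>
      ell2_op_norm G (left_regular G (radial K a)) \<le> C * (\<Sum>k\<in>K. (real k + 1) * (a k * sqrt (growth k)))"
proof -
  obtain C where C: "0 < C"
    "\<And>k x. x \<in> carrier G \<Longrightarrow> (\<Sum>g\<in>sphere k. \<phi> (inv g \<otimes> x)) \<le> C * (real k + 1) * sqrt (growth k) * \<phi> x"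
    using sphere_sum_upper by blast
  obtain c where c: "0 < c"
    "\<And>k x. x \<in> carrier G \<Longrightarrow> k \<le> len x \<Longrightarrow> c * (real k + 1) * sqrt (growth k) * \<phi> x \<le> (\<Sum>g\<in>sphere k. \<phi> (inv g \<otimes> x))"
    using sphere_sum_lower by blast
  have "c / 2 * (\<Sum>k\<in>K. (real k + 1) * (a k * sqrt (growth k))) \<le> ell2_op_norm G (left_regular G (radial K a)) \<and>
      ell2_op_norm G (left_regular G (radial K a)) \<le> C * (\<Sum>k\<in>K. (real k + 1) * (a k * sqrt (growth k)))"
    if K: "finite K" and a: "\<forall>k\<in>K. 0 \<le> a k" for K a
  proof
    define N where "N = (\<Sum>k\<in>K. (real k + 1) * (a k * sqrt (growth k)))"
    have N: "0 \<le> N" unfolding N_def using a growth_pos by (auto intro!: sum_nonneg mult_nonneg_nonneg simp: less_imp_le)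
    have dist: "D * N * \<phi> x = (\<Sum>k\<in>K. a k * (D * (real k + 1) * sqrt (growth k) * \<phi> x))" for D x
      unfolding N_def sum_distrib_left sum_distrib_right by (intro sum.cong) auto
    obtain r where r: "\<And>k. k \<in> K \<Longrightarrow> k \<le> r" using K by (meson Max_ge)
    have "c * N * \<phi> x \<le> (\<Sum>k\<in>K. a k * (\<Sum>g\<in>sphere k. \<phi> (inv g \<otimes> x)))"
      if x: "x \<in> carrier G" "r \<le> len x" for x
      unfolding dist using c(2)[OF x(1)] r x a by (intro sum_mono mult_left_mono) (auto intro: order_trans)
    then show "c / 2 * (\<Sum>k\<in>K. (real k + 1) * (a k * sqrt (growth k))) \<le> ell2_op_norm G (left_regular G (radial K a))"
      using op_norm_lower[OF K, of a "c * N" r] a r N c(1) by (simp add: N_def)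
    have "(\<Sum>k\<in>K. a k * (\<Sum>g\<in>sphere k. \<phi> (inv g \<otimes> x))) \<le> C * N * \<phi> x" if x: "x \<in> carrier G" for x
      unfolding dist using C(2)[OF x] a by (intro sum_mono mult_left_mono) auto
    then show "ell2_op_norm G (left_regular G (radial K a)) \<le> C * (\<Sum>k\<in>K. (real k + 1) * (a k * sqrt (growth k)))"
      using op_norm_upper[OF K, of a "C * N"] a N C(1) by (simp add: N_def)
  qed
  then show thesis using that[of "c / 2" C] c C by simp
qed

end

theorem mainTheorem1:
  fixes G :: "('a, 'b) monoid_scheme" and S :: "'a set"
  assumes "hyperbolic_group G"
    and "non_elementary G"
    and "fin_sym_gen_set G S"
  shows "\<exists>c C :: real. c > 0 \<and> C > 0 \<and>
    (\<forall>(K :: nat set) (a :: nat \<Rightarrow> real). finite K \<longrightarrow> (\<forall>k\<in>K. a k \<ge> 0) \<longrightarrow>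
      (let N = (\<Sum>k\<in>K. (real k + 1) * ell2_norm G (\<lambda>x. complex_of_real (a k) * sphere_sum G S k x));
           L = ell2_op_norm G (left_regular G (\<lambda>x. \<Sum>k\<in>K. complex_of_real (a k) * sphere_sum G S k x))
       in c * N \<le> L \<and> L \<le> C * N))"
proof -
  interpret group G using assms(1) by (simp add: hyperbolic_group_def)
  interpret word_group G S by unfold_locales (rule assms(3))
  obtain \<delta> where "hyperbolic_space (carrier G) dst \<delta>" using hyperbolic_word_dist[OF assms(1)] by blast
  then interpret hyperbolic_space "carrier G" dst \<delta> .
  interpret hyperbolic_word_group G S \<delta> by unfold_locales
  obtain A F where AF: "0 \<le> A" "finite F" "F \<subseteq> carrier G" "\<And>f. f \<in> F \<Longrightarrow> 4 * A + 2 * \<delta> + 1 \<le> len f"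
    "\<And>u t w. u \<in> carrier G \<Longrightarrow> t \<in> carrier G \<Longrightarrow> w \<in> carrier G \<Longrightarrow>
      \<exists>f\<in>F. gp \<one>\<^bsub>G\<^esub> (inv\<^bsub>G\<^esub> u) f \<le> A \<and> gp \<one>\<^bsub>G\<^esub> t f \<le> A \<and> gp \<one>\<^bsub>G\<^esub> (inv\<^bsub>G\<^esub> f) w \<le> A"
    using exists_connecting_set[OF assms(2)] by blast
  interpret connecting_set G S \<delta> A F
    by unfold_locales (use AF assms(2) in \<open>auto simp: non_elementary_def\<close>)
  obtain c C where cC: "0 < c" "0 < C"
    "\<And>K a. finite K \<Longrightarrow> (\<forall>k\<in>K. 0 \<le> a k) \<Longrightarrow>
      c * (\<Sum>k\<in>K. (real k + 1) * (a k * sqrt (growth k))) \<le> ell2_op_norm G (left_regular G (radial K a)) \<and>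
      ell2_op_norm G (left_regular G (radial K a)) \<le> C * (\<Sum>k\<in>K. (real k + 1) * (a k * sqrt (growth k)))"
    using radial_norm_equivalence by blast
  have "(\<Sum>k\<in>K. (real k + 1) * ell2_norm G (\<lambda>x. complex_of_real (a k) * sphere_sum G S k x))
    = (\<Sum>k\<in>K. (real k + 1) * (a k * sqrt (growth k)))" if "\<forall>k\<in>K. 0 \<le> a k" for K a
    using that ell2_norm_sphere by (intro sum.cong) auto
  then show ?thesis
    using cC by (intro exI[of _ c] exI[of _ C]) (simp add: radial_def Let_def)
qed

end
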